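(* Assume $f$ is $L$-smooth and the generalized heavy-tailed noise assumption holds with $\alpha\in(1,2]$, $\sigma_0,\sigma_1\ge0$. Let $K\ge1$, $\eta>0$, $\beta\in(0,1)$ and batch size $B>\big(2\sqrt\pi(1+\sqrt{d_0})\mathcal C_\alpha^{1/\alpha}\sigma_1\big)^{\alpha/(\alpha-1)}$, and put $\rho:=1-(1+\sqrt{d_0})\,2\sqrt\pi\,\mathcal C_\alpha^{1/\alpha}\sigma_1/B^{(\alpha-1)/\alpha}>0$, $\Gamma_\alpha:=(2^\alpha+1)^{1/\alpha}$. Then Muon with exact polar decomposition satisfies $$\min_{0\le k\le K-1}\mathbb E\|\nabla f({\bm{X}}_k)\|_F\le\frac{f({\bm{X}}_0)-f_\star}{\eta\rho K}+\frac{Ld_0\eta}{2\rho}+(1+\sqrt{d_0})\frac{\mathbb E\|{\bm{S}}_0\|_F}{(1-\beta)K\rho}+\frac{\beta^2}{(1-\beta)\rho}L\eta\sqrt{d_0}(1+\sqrt{d_0})+(1+\sqrt{d_0})\frac{2\sqrt\pi\,\mathcal C_\alpha^{1/\alpha}}{\rho B^{(\alpha-1)/\alpha}}\Gamma_\alpha\sigma_0(1-\beta)^{\frac{\alpha-1}{\alpha}}+(1+\sqrt{d_0})\frac{2\sqrt\pi\,\mathcal C_\alpha^{1/\alpha}\sigma_1\|\nabla f({\bm{X}}_0)\|_F}{\rho B^{(\alpha-1)/\alpha}K}.$$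
   Context: Norms on $\mathbb{R}^{m\times n}$: $\|\cdot\|_F$ Frobenius; $d_0:=\min\{m,n\}$. $f:\mathbb{R}^{m\times n}\to\mathbb R$ is differentiable with $f\ge f_\star>-\infty$; $L$-smooth means $\|\nabla f({\bm{X}})-\nabla f({\bm{Y}})\|_F\le L\|{\bm{X}}-{\bm{Y}}\|_F$. Muon: given $\beta\in(0,1)$, $\eta>0$, $B\in\mathbb N$, initial ${\bm{X}}_0,{\bm{C}}_{-1}$, for $k=0,1,\dots$: ${\bm{G}}_k=\frac1B\sum_{i=1}^B{\bm{G}}_k^i$, ${\bm{C}}_k=\beta{\bm{C}}_{k-1}+{\bm{G}}_k$, ${\bm{M}}_k=\beta{\bm{C}}_k+{\bm{G}}_k$, ${\bm{X}}_{k+1}={\bm{X}}_k-\eta\mathcal T({\bm{M}}_k)$, with exact polar decomposition $\mathcal T({\bm{M}})={\bm{U}}{\bm{V}}^\top$ for a compact SVD ${\bm{M}}={\bm{U}}\bm\Sigma{\bm{V}}^\top$ ($\mathcal T(\mathbf 0)=\mathbf 0$). $\widetilde{{\bm{M}}}_k:=(1-\beta){\bm{M}}_k$, ${\bm{S}}_k:=\widetilde{{\bm{M}}}_k-\nabla f({\bm{X}}_k)$. $\mathcal F_k$ is the $\sigma$-field of all randomness up to the beginning of iteration $k$ (${\bm{X}}_k$ is $\mathcal F_k$-measurable, ${\bm{G}}_k^i$ are $\mathcal F_{k+1}$-measurable). Generalized heavy-tailed noise assumption: for every $k$, conditionally on $\mathcal F_k$, ${\bm{G}}_k^1,\dots,{\bm{G}}_k^B$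 are independent, $\mathbb E[{\bm{G}}_k^i\mid\mathcal F_k]=\nabla f({\bm{X}}_k)$, and $\mathbb E[\|{\bm{G}}_k^i-\nabla f({\bm{X}}_k)\|_F^\alpha\mid\mathcal F_k]\le\sigma_0^\alpha+\sigma_1^\alpha\|\nabla f({\bm{X}}_k)\|_F^\alpha$. $\mathcal C_\alpha\in(0,2]$ is a constant depending only on $\alpha$ such that for any finitely many independent mean-zero random elements ${\bm{Y}}_i$ of a real Hilbert space with finite $\alpha$-th moments, $\mathbb E\|\sum_i{\bm{Y}}_i\|^\alpha\le\mathcal C_\alpha\sum_i\mathbb E\|{\bm{Y}}_i\|^\alpha$. *)

theory Defs
  imports "HOL-Probability.Probability"
begin

definition outer :: "real^'m \<Rightarrow> real^'n \<Rightarrow> real^'n^'m" where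
  "outer u v = (\<chi> a b. u $ a * v $ b)"

(* Q = U V^T for a compact SVD M = U Sigma V^T, written as sums of rank-one terms *)
definition is_polar_factor :: "real^'n^'m \<Rightarrow> real^'n^'m \<Rightarrow> bool" where
  "is_polar_factor M Q \<longleftrightarrow>
     (\<exists>(r::nat) (u::nat \<Rightarrow> real^'m) (v::nat \<Rightarrow> real^'n) (s::nat \<Rightarrow> real).
        (\<forall>i<r. \<forall>j<r. u i \<bullet> u j = (if i = j then 1 else 0)) \<and>
        (\<forall>i<r. \<forall>j<r. v i \<bullet> v j = (if i = j then 1 else 0)) \<and>
        (\<forall>i<r. s i > 0) \<and>
        M = (\<Sum>i<r. s i *\<^sub>R outer (u i) (v i)) \<and>
        Q = (\<Sum>i<r. outer (u i) (v i)))"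

(* exact polar factor T(M) (well defined since U V^T does not depend on the compact SVD) *)
definition polar :: "real^'n^'m \<Rightarrow> real^'n^'m" where
  "polar M = (SOME Q. is_polar_factor M Q)"

definition batch_mean :: "(nat \<Rightarrow> nat \<Rightarrow> 'w \<Rightarrow> real^'n^'m) \<Rightarrow> nat \<Rightarrow> nat \<Rightarrow> 'w \<Rightarrow> real^'n^'m" where
  "batch_mean G B k w = (1 / real B) *\<^sub>R (\<Sum>i\<in>{1..B}. G k i w)"

(* muon_Cprev beta Cm1 Gb k = C_{k-1} *)
primrec muon_Cprev :: "real \<Rightarrow> real^'n^'m \<Rightarrow> (nat \<Rightarrow> real^'n^'m) \<Rightarrow> nat \<Rightarrow> real^'n^'m" where
  "muon_Cprev \<beta> Cm1 Gb 0 = Cm1"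
| "muon_Cprev \<beta> Cm1 Gb (Suc k) = \<beta> *\<^sub>R muon_Cprev \<beta> Cm1 Gb k + Gb k"

definition muon_C :: "real \<Rightarrow> real^'n^'m \<Rightarrow> (nat \<Rightarrow> real^'n^'m) \<Rightarrow> nat \<Rightarrow> real^'n^'m" where
  "muon_C \<beta> Cm1 Gb k = \<beta> *\<^sub>R muon_Cprev \<beta> Cm1 Gb k + Gb k"

definition muon_M :: "real \<Rightarrow> real^'n^'m \<Rightarrow> (nat \<Rightarrow> real^'n^'m) \<Rightarrow> nat \<Rightarrow> real^'n^'m" where
  "muon_M \<beta> Cm1 Gb k = \<beta> *\<^sub>R muon_C \<beta> Cm1 Gb k + Gb k"

primrec muon_X :: "real \<Rightarrow> real \<Rightarrow> real^'n^'m \<Rightarrow> real^'n^'m \<Rightarrow> (nat \<Rightarrow> real^'n^'m) \<Rightarrow> nat \<Rightarrow> real^'n^'m" where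
  "muon_X \<eta> \<beta> X0 Cm1 Gb 0 = X0"
| "muon_X \<eta> \<beta> X0 Cm1 Gb (Suc k) = muon_X \<eta> \<beta> X0 Cm1 Gb k - \<eta> *\<^sub>R polar (muon_M \<beta> Cm1 Gb k)"

(* the constant C_alpha: von Bahr--Esseen type inequality for independent mean-zero
   random elements of the Hilbert space real^'n^'m *)
definition vbe_constant :: "real \<Rightarrow> real \<Rightarrow> ('n::finite) itself \<Rightarrow> ('m::finite) itself \<Rightarrow> bool" where
  "vbe_constant \<alpha> C (_::'n itself) (_::'m itself) \<longleftrightarrow>
     (\<forall>(Q::(nat \<Rightarrow> real^'n^'m) measure) (Y::nat \<Rightarrow> (nat \<Rightarrow> real^'n^'m) \<Rightarrow> real^'n^'m) (N::nat).
        prob_space Q \<longrightarrow>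
        prob_space.indep_vars Q (\<lambda>_. borel) Y {..<N} \<longrightarrow>
        (\<forall>i<N. integrable Q (Y i) \<and> (\<integral>x. Y i x \<partial>Q) = 0 \<and>
               (\<integral>\<^sup>+x. ennreal (norm (Y i x) powr \<alpha>) \<partial>Q) < \<infinity>) \<longrightarrow>
        (\<integral>\<^sup>+x. ennreal (norm (\<Sum>i<N. Y i x) powr \<alpha>) \<partial>Q)
          \<le> ennreal C * (\<Sum>i<N. \<integral>\<^sup>+x. ennreal (norm (Y i x) powr \<alpha>) \<partial>Q))"

end

theory Submission
  imports Defs
begin

text \<open>
  Along the iterates the descent lemma together with
  \<open>\<langle>M, polar M\<rangle> \<ge> norm M\<close> and \<open>norm (polar M) \<le> sqrt d\<close> (where \<open>d = min m n\<close>) gives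
  \<open>f (X (k+1)) \<le> f (X k) - \<eta> \<parallel>\<nabla>f (X k)\<parallel> + \<eta> (1 + sqrt d) \<parallel>S k\<parallel> + L d \<eta>\<^sup>2 / 2\<close>,
  so only the momentum errors \<open>S k\<close> have to be summed. Unrolling the recursion, \<open>S k\<close> is a
  geometrically damped \<open>S 0\<close>, plus a drift of size \<open>\<beta>\<^sup>2 L \<eta> sqrt d / (1 - \<beta>)\<close>, plus a weighted sum
  of the noises of all samples seen so far.

  The noise sum is a martingale. With \<open>x\<close> the sum so far and \<open>y\<close> one further sample,
  \<open>\<parallel>x + y\<parallel>\<^sup>\<alpha> \<le> \<parallel>x\<parallel>\<^sup>\<alpha> + \<alpha> \<parallel>x\<parallel>\<^bsup>\<alpha>-2\<^esup> \<langle>x, y\<rangle> + 3\<^sup>\<alpha> \<parallel>y\<parallel>\<^sup>\<alpha>\<close> controls the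
  \<open>\<alpha>\<close>-th moment, the samples of one batch being processed one after the other. Because the
  conditional moment bound is itself random, the estimate is iterated for the potential
  \<open>(A + \<parallel>x\<parallel>\<^sup>\<alpha>)\<^bsup>1/\<alpha>\<^esup>\<close>: by concavity each step adds the deterministic \<open>\<sigma>0\<close> part to \<open>A\<close> and
  splits off the \<open>\<sigma>1\<close> part linearly in the gradient norm. The resulting constant \<open>3\<close> is at most
  \<open>2 sqrt \<pi> C\<^bsup>1/\<alpha>\<^esup>\<close>, since every von Bahr--Esseen constant \<open>C\<close> is at least \<open>1\<close>.
\<close>

section \<open>Singular values and the polar factor\<close>

text \<open>The witnesses hidden in \<open>is_polar_factor\<close>, without the factor itself, so
  that one decomposition can be built by induction and reused for every function of the singular
  values.\<close>

definition compact_svd ::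
  "nat \<Rightarrow> (nat \<Rightarrow> real^'m) \<Rightarrow> (nat \<Rightarrow> real) \<Rightarrow> (nat \<Rightarrow> real^'n) \<Rightarrow> real^'n^'m \<Rightarrow> bool" where
  "compact_svd r u s v M \<longleftrightarrow>
     (\<forall>i<r. \<forall>j<r. u i \<bullet> u j = (if i = j then 1 else 0)) \<and>
     (\<forall>i<r. \<forall>j<r. v i \<bullet> v j = (if i = j then 1 else 0)) \<and>
     (\<forall>i<r. s i > 0) \<and>
     M = (\<Sum>i<r. s i *\<^sub>R outer (u i) (v i))"

lemma is_polar_factor_iff_svd:
  "is_polar_factor M Q \<longleftrightarrow>
     (\<exists>r u s v. compact_svd r u s v M \<and> Q = (\<Sum>i<r. outer (u i) (v i)))"
  unfolding is_polar_factor_def compact_svd_def by blast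

section \<open>Rank-one matrices and orthonormal families\<close>

lemma inner_outer: "M \<bullet> outer u v = u \<bullet> (M *v v)"
  unfolding outer_def inner_vec_def matrix_vector_mult_def
  by (simp add: sum_distrib_left mult.assoc mult.left_commute mult.commute)

lemma outer_mult_vec: "outer u v *v x = (v \<bullet> x) *\<^sub>R u"
  unfolding outer_def inner_vec_def matrix_vector_mult_def vec_eq_iff
  by (simp add: sum_distrib_left mult.assoc mult.left_commute mult.commute)

lemma transpose_outer: "transpose (outer u v) = outer v u"
  unfolding outer_def transpose_def vec_eq_iff by (simp add: mult.commute)

lemma outer_inner_outer: "outer u v \<bullet> outer u' v' = (u \<bullet> u') * (v \<bullet> v')"
  by (simp add: inner_outer outer_mult_vec inner_commute)

lemma sum_matrix_vector_mult: "(\<Sum>i\<in>I. A i) *v x = (\<Sum>i\<in>I. A i *v x)"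
  by (induction I rule: infinite_finite_induct) (auto simp: matrix_vector_mult_add_rdistrib)

lemma transpose_sum: "transpose (\<Sum>i\<in>I. A i) = (\<Sum>i\<in>I. transpose (A i))"
  unfolding transpose_def vec_eq_iff by simp

lemma sum_outer_mult_vec:
  "(\<Sum>i\<in>I. t i *\<^sub>R outer (u i) (v i)) *v x = (\<Sum>i\<in>I. (t i * (v i \<bullet> x)) *\<^sub>R u i)"
  by (simp add: sum_matrix_vector_mult scaleR_matrix_vector_assoc[symmetric] outer_mult_vec)

lemma inner_sum_orthonormal:
  fixes u :: "nat \<Rightarrow> 'a::real_inner"
  assumes "\<forall>i<r. \<forall>j<r. u i \<bullet> u j = (if i = j then 1 else 0)" "j < r"
  shows "u j \<bullet> (\<Sum>i<r. c i *\<^sub>R u i) = c j"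
proof -
  have "u j \<bullet> (\<Sum>i<r. c i *\<^sub>R u i) = (\<Sum>i<r. if i = j then c i else 0)"
    unfolding inner_sum_right using assms by (intro sum.cong) auto
  then show ?thesis using assms(2) by simp
qed

lemma orthonormal_card_le:
  fixes u :: "nat \<Rightarrow> 'a::euclidean_space"
  assumes "\<forall>i<r. \<forall>j<r. u i \<bullet> u j = (if i = j then 1 else 0)"
  shows "r \<le> DIM('a)"
proof -
  have inj: "inj_on u {..<r}"
    using assms by (intro inj_onI) (metis lessThan_iff zero_neq_one)
  have "pairwise orthogonal (u ` {..<r})"
    unfolding pairwise_def orthogonal_def using assms by auto
  moreover have "0 \<notin> u ` {..<r}"
    using assms by (metis imageE inner_zero_left lessThan_iff zero_neq_one)
  ultimately have "independent (u ` {..<r})"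
    by (rule pairwise_orthogonal_independent)
  then have "card (u ` {..<r}) \<le> DIM('a)"
    by (simp add: independent_bound)
  then show ?thesis by (simp add: card_image[OF inj])
qed

text \<open>The bilinear form \<open>u \<bullet> (M *v v)\<close> attains its maximum
  \<open>s\<close> on the compact product of the unit spheres. At a maximiser, Cauchy--Schwarz holds
  with equality in both arguments, which forces the two singular vector equations.\<close>

lemma exists_top_singular_pair:
  fixes M :: "real^'n^'m"
  assumes "M \<noteq> 0"
  obtains u v s where "norm u = 1" "norm v = 1" "s > 0"
    "M *v v = s *\<^sub>R u" "u v* M = s *\<^sub>R v"
proof -
  let ?S = "sphere (0::real^'m) 1 \<times> sphere (0::real^'n) 1"
  let ?g = "\<lambda>p. fst p \<bullet> (M *v snd p)"
  have ne: "?S \<noteq> {}"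
    by simp
  have cont: "continuous_on ?S ?g"
    by (intro continuous_intros linear_continuous_on_compose[OF _ matrix_vector_mul_linear])
  obtain p where p: "p \<in> ?S" "\<And>q. q \<in> ?S \<Longrightarrow> ?g q \<le> ?g p"
    using continuous_attains_sup[OF compact_Times[OF compact_sphere compact_sphere] ne cont] by blast
  define u v s where "u = fst p" and "v = snd p" and "s = ?g p"
  have nu: "norm u = 1" and nv: "norm v = 1"
    using p(1) by (auto simp: u_def v_def mem_Times_iff)
  have max: "u' \<bullet> (M *v v') \<le> s" if "norm u' = 1" "norm v' = 1" for u' v'
    using p(2)[of "(u', v')"] that by (simp add: s_def)
  have uMv: "u \<bullet> (M *v v) = s" by (simp add: u_def v_def s_def)
  \<comment> \<open>Maximality is tested with the normalised image of \<open>v'\<close>; together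
    with \<open>bound2\<close> this bounds the images of unit vectors under \<open>M\<close> and its
    transpose by \<open>s\<close>.\<close>
  have bound1: "norm (M *v v') \<le> s" if "norm v' = 1" "M *v v' \<noteq> 0" for v'
    using max[of "(1 / norm (M *v v')) *\<^sub>R (M *v v')" v'] that
    by (simp add: dot_square_norm power2_eq_square)
  have bound2: "norm (u' v* M) \<le> s" if "norm u' = 1" "u' v* M \<noteq> 0" for u'
    using max[of u' "(1 / norm (u' v* M)) *\<^sub>R (u' v* M)"] that
    by (simp add: dot_lmul_matrix[symmetric] dot_square_norm power2_eq_square)
  obtain x where x: "M *v x \<noteq> 0"
    using assms matrix_eq[of M 0] by auto
  then have "x \<noteq> 0" by auto
  then have "0 < norm (M *v ((1 / norm x) *\<^sub>R x))"
    using x by (simp add: matrix_vector_mult_scaleR)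
  also have "\<dots> \<le> s"
    using bound1[of "(1 / norm x) *\<^sub>R x"] \<open>x \<noteq> 0\<close> x by (simp add: matrix_vector_mult_scaleR)
  finally have s: "s > 0" .
  \<comment> \<open>Equality case of Cauchy--Schwarz, read off from the expansion of the squared
    distance between \<open>a\<close> and \<open>s *\<^sub>R b\<close>.\<close>
  have eq: "a = s *\<^sub>R b" if "norm b = 1" "b \<bullet> a = s" "norm a \<le> s" for a b :: "'z::real_inner"
  proof -
    have "(norm (a - s *\<^sub>R b))\<^sup>2 = (norm a)\<^sup>2 - s\<^sup>2"
      using that(1,2) norm_eq_1[of b] unfolding power2_norm_eq_inner
      by (simp add: inner_diff_left inner_diff_right inner_commute algebra_simps power2_eq_square)
    also have "\<dots> \<le> 0" using that(3) by (simp add: power_mono)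
    finally show ?thesis by simp
  qed
  have "M *v v \<noteq> 0" "u v* M \<noteq> 0"
    using uMv s dot_lmul_matrix[of u M v] by auto
  then have "M *v v = s *\<^sub>R u" "u v* M = s *\<^sub>R v"
    using eq[of u "M *v v"] eq[of v "u v* M"] bound1[OF nv] bound2[OF nu] nu nv uMv
      dot_lmul_matrix[of u M v] by (auto simp: inner_commute)
  then show ?thesis using that nu nv s by blast
qed

lemma compact_svd_mult_vec:
  assumes "compact_svd r u s v M" "j < r"
  shows "M *v v j = s j *\<^sub>R u j" "u j \<bullet> (M *v x) = s j * (v j \<bullet> x)"
proof -
  have M: "M = (\<Sum>i<r. s i *\<^sub>R outer (u i) (v i))"
    and u: "\<forall>i<r. \<forall>j<r. u i \<bullet> u j = (if i = j then 1 else 0)"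
    and v: "\<forall>i<r. \<forall>j<r. v i \<bullet> v j = (if i = j then 1 else 0)"
    using assms(1) unfolding compact_svd_def by auto
  have "M *v v j = (\<Sum>i<r. if i = j then s i *\<^sub>R u i else 0)"
    unfolding M sum_outer_mult_vec using v assms(2) by (intro sum.cong) auto
  then show "M *v v j = s j *\<^sub>R u j" using assms(2) by simp
  show "u j \<bullet> (M *v x) = s j * (v j \<bullet> x)"
    unfolding M sum_outer_mult_vec using inner_sum_orthonormal[OF u assms(2)] by simp
qed

text \<open>Deflation: subtracting the top rank-one term enlarges the kernel strictly. The measure
  of the induction is the rank, written as codimension of the kernel.\<close>

lemma exists_compact_svd:
  fixes M :: "real^'n^'m"
  shows "\<exists>r u s v. compact_svd r u s v M"
proof (induction "CARD('n) - dim {x. M *v x = 0}" arbitrary: M rule: less_induct)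
  case less
  show ?case
  proof (cases "M = 0")
    case True
    then have "compact_svd 0 (\<lambda>_. 0) (\<lambda>_. 0) (\<lambda>_. 0) M"
      by (simp add: compact_svd_def)
    then show ?thesis by blast
  next
    case False
    then obtain u0 v0 s0 where *: "norm u0 = 1" "norm v0 = 1" "s0 > 0"
      "M *v v0 = s0 *\<^sub>R u0" "u0 v* M = s0 *\<^sub>R v0"
      by (rule exists_top_singular_pair)
    define M' where "M' = M - s0 *\<^sub>R outer u0 v0"
    have M'x: "M' *v x = M *v x - (s0 * (v0 \<bullet> x)) *\<^sub>R u0" for x
      by (simp add: M'_def matrix_vector_mult_diff_rdistrib scaleR_matrix_vector_assoc[symmetric] outer_mult_vec)
    have u0M: "u0 \<bullet> (M *v x) = s0 * (v0 \<bullet> x)" for x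
      using *(5) dot_lmul_matrix[of u0 M x] by simp
    have M'v0: "M' *v v0 = 0"
      using * by (simp add: M'x dot_square_norm)
    have u0M': "u0 \<bullet> (M' *v x) = 0" for x
      using * by (simp add: M'x inner_diff_right u0M dot_square_norm)
    have sub: "subspace {x. A *v x = 0}" for A :: "real^'n^'m"
      by (auto simp: subspace_def matrix_vector_right_distrib matrix_vector_mult_scaleR)
    \<comment> \<open>A kernel vector of \<open>M\<close> is orthogonal to \<open>v0\<close> because
      \<open>s0 > 0\<close>, so the deflation does not affect it; \<open>v0\<close> itself is new in
      the kernel.\<close>
    have "{x. M *v x = 0} \<subseteq> {x. M' *v x = 0}"
    proof safe
      fix x assume x: "M *v x = 0"
      then have "v0 \<bullet> x = 0" using u0M[of x] *(3) by simp
      then show "M' *v x = 0" using x by (simp add: M'x)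
    qed
    moreover have "v0 \<in> {x. M' *v x = 0}" "v0 \<notin> {x. M *v x = 0}"
      using M'v0 * by auto
    ultimately have "{x. M *v x = 0} \<subset> {x. M' *v x = 0}" by blast
    then have "dim {x. M *v x = 0} < dim {x. M' *v x = 0}"
      using sub by (metis dim_psubset span_eq_iff)
    moreover have "dim {x. M' *v x = 0} \<le> CARD('n)"
      using dim_subset_UNIV[of "{x. M' *v x = 0}"] by simp
    ultimately have "CARD('n) - dim {x. M' *v x = 0} < CARD('n) - dim {x. M *v x = 0}"
      by linarith
    then obtain r u s v where svd: "compact_svd r u s v M'"
      using less by blast
    \<comment> \<open>\<open>M'\<close> annihilates \<open>v0\<close> and its range is orthogonal to
      \<open>u0\<close>. Dividing by \<open>s i > 0\<close> transfers both facts to the singular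
      vectors of \<open>M'\<close>, so the families can be extended.\<close>
    have uu: "u i \<bullet> u0 = 0" "v i \<bullet> v0 = 0" if "i < r" for i
    proof -
      have "s i > 0" using svd that by (auto simp: compact_svd_def)
      then show "u i \<bullet> u0 = 0" "v i \<bullet> v0 = 0"
        using compact_svd_mult_vec(1)[OF svd that] u0M'[of "v i"]
          compact_svd_mult_vec(2)[OF svd that, of v0] M'v0
        by (auto simp: inner_commute)
    qed
    have "compact_svd (Suc r) (u(r := u0)) (s(r := s0)) (v(r := v0)) M"
      unfolding compact_svd_def
    proof (intro conjI)
      have "M = M' + s0 *\<^sub>R outer u0 v0" by (simp add: M'_def)
      also have "M' = (\<Sum>i<r. s i *\<^sub>R outer (u i) (v i))"
        using svd by (simp add: compact_svd_def)
      finally show "M = (\<Sum>i<Suc r. (s(r := s0)) i *\<^sub>R outer ((u(r := u0)) i) ((v(r := v0)) i))"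
        by simp
    qed (use svd uu * in \<open>auto simp: compact_svd_def less_Suc_eq dot_square_norm inner_commute\<close>)
    then show ?thesis by blast
  qed
qed

lemma is_polar_factor_polar: "is_polar_factor M (polar M)"
  unfolding polar_def
  by (rule someI_ex) (use exists_compact_svd[of M] in \<open>auto simp: is_polar_factor_iff_svd\<close>)

lemma compact_svd_inner_sum_outer:
  assumes "compact_svd r u s v M"
  shows "(\<Sum>i<r. t i *\<^sub>R outer (u i) (v i)) \<bullet> (\<Sum>i<r. t' i *\<^sub>R outer (u i) (v i)) = (\<Sum>i<r. t i * t' i)"
proof -
  have "(\<Sum>i<r. t i *\<^sub>R outer (u i) (v i)) \<bullet> (\<Sum>i<r. t' i *\<^sub>R outer (u i) (v i))
      = (\<Sum>i<r. \<Sum>j<r. if j = i then t i * t' j else 0)"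
    unfolding inner_sum_left inner_sum_right using assms
    by (intro sum.cong) (auto simp: compact_svd_def outer_inner_outer)
  then show ?thesis by simp
qed

text \<open>The rank-one terms are orthonormal for the Frobenius inner product. Hence
  \<open>norm Q\<close> is the square root of the rank, and \<open>M \<bullet> Q\<close> is the sum
  of the singular values (the nuclear norm), which dominates the Frobenius norm by the triangle
  inequality.\<close>

lemma polar_factor_norm:
  fixes M Q :: "real^'n^'m"
  assumes "is_polar_factor M Q"
  shows "norm Q \<le> sqrt (min CARD('m) CARD('n))" "norm M \<le> M \<bullet> Q"
proof -
  obtain r u s v where svd: "compact_svd r u s v M" and Q: "Q = (\<Sum>i<r. 1 *\<^sub>R outer (u i) (v i))"
    using assms by (auto simp: is_polar_factor_iff_svd)
  have M: "M = (\<Sum>i<r. s i *\<^sub>R outer (u i) (v i))" and s: "\<forall>i<r. s i > 0"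
    using svd by (auto simp: compact_svd_def)
  have "r \<le> CARD('m)" "r \<le> CARD('n)"
    using orthonormal_card_le[of r u] orthonormal_card_le[of r v] svd by (auto simp: compact_svd_def)
  moreover have "(norm Q)\<^sup>2 = r"
    unfolding power2_norm_eq_inner Q compact_svd_inner_sum_outer[OF svd] by simp
  ultimately show "norm Q \<le> sqrt (min CARD('m) CARD('n))"
    by (intro real_le_rsqrt) auto
  have "norm M \<le> (\<Sum>i<r. norm (s i *\<^sub>R outer (u i) (v i)))"
    unfolding M by (rule norm_sum)
  also have "\<dots> = (\<Sum>i<r. s i * 1)"
    using s svd by (intro sum.cong)
      (auto simp: norm_eq_sqrt_inner outer_inner_outer compact_svd_def)
  also have "\<dots> = M \<bullet> Q"
    unfolding Q M compact_svd_inner_sum_outer[OF svd] by simp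
  finally show "norm M \<le> M \<bullet> Q" .
qed

text \<open>
  The Newton--Schulz iteration keeps the singular vectors and drives all singular values of
  \<open>M / norm M\<close> to \<open>1\<close>. Hence every polar factor of \<open>M\<close> is its limit, which gives both
  uniqueness and Borel measurability of \<open>polar\<close>.
\<close>

primrec newton_schulz :: "nat \<Rightarrow> real^'n^'m \<Rightarrow> real^'n^'m" where
  "newton_schulz 0 M = (1 / norm M) *\<^sub>R M"
| "newton_schulz (Suc n) M =
     (3/2) *\<^sub>R newton_schulz n M
     - (1/2) *\<^sub>R (newton_schulz n M ** transpose (newton_schulz n M) ** newton_schulz n M)"

text \<open>Orthonormality of both families makes \<open>Y ** transpose Y ** Y\<close> cube the
  singular values and keep the singular vectors, so the matrix iteration reduces to a scalar
  one.\<close>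

lemma newton_schulz_compact_svd:
  assumes "compact_svd r u s v M"
  shows "newton_schulz n M
    = (\<Sum>i<r. (((\<lambda>t. 3/2 * t - t^3/2) ^^ n) (s i / norm M)) *\<^sub>R outer (u i) (v i))"
proof (induction n)
  case 0
  have "(1 / norm M) *\<^sub>R (\<Sum>i<r. s i *\<^sub>R outer (u i) (v i)) = (\<Sum>i<r. (s i / norm M) *\<^sub>R outer (u i) (v i))"
    by (simp add: scaleR_sum_right)
  then show ?case using assms by (simp add: compact_svd_def)
next
  case (Suc n)
  have u: "\<forall>i<r. \<forall>j<r. u i \<bullet> u j = (if i = j then 1 else 0)"
    and v: "\<forall>i<r. \<forall>j<r. v i \<bullet> v j = (if i = j then 1 else 0)"
    using assms unfolding compact_svd_def by auto
  define t where "t i = ((\<lambda>t. 3/2 * t - t^3/2) ^^ n) (s i / norm M)" for i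
  define Y where "Y = (\<Sum>i<r. t i *\<^sub>R outer (u i) (v i))"
  have Y: "newton_schulz n M = Y"
    unfolding Y_def t_def by (rule Suc)
  have YT: "transpose Y = (\<Sum>i<r. t i *\<^sub>R outer (v i) (u i))"
    by (simp add: Y_def transpose_sum transpose_scalar transpose_outer)
  have "Y ** transpose Y ** Y = (\<Sum>i<r. (t i ^ 3) *\<^sub>R outer (u i) (v i))"
    unfolding matrix_eq
  proof
    fix x
    have "Y ** transpose Y ** Y *v x = Y *v (transpose Y *v (Y *v x))"
      by (simp add: matrix_vector_mul_assoc matrix_mul_assoc)
    also have "\<dots> = (\<Sum>i<r. (t i ^ 3 * (v i \<bullet> x)) *\<^sub>R u i)"
      unfolding YT unfolding Y_def sum_outer_mult_vec
      using inner_sum_orthonormal[OF u] inner_sum_orthonormal[OF v]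
      by (intro sum.cong) (auto simp: power3_eq_cube)
    finally show "Y ** transpose Y ** Y *v x = (\<Sum>i<r. (t i ^ 3) *\<^sub>R outer (u i) (v i)) *v x"
      by (simp add: sum_outer_mult_vec)
  qed
  moreover have "((\<lambda>t. 3/2 * t - t^3/2) ^^ Suc n) (s i / norm M) = 3/2 * t i - (t i)^3/2" for i
    by (simp add: t_def)
  ultimately show ?case
    unfolding newton_schulz.simps Y
    by (simp only:) (simp add: Y_def scaleR_sum_right sum_subtractf[symmetric] scaleR_diff_left)
qed

text \<open>The iterates stay in \<open>[t, 1]\<close>, and one step multiplies the error
  \<open>1 - x\<close> by \<open>1 - (x + x\<^sup>2) / 2\<close>, which is at most
  \<open>1 - t/2\<close> there. Convergence is therefore at least geometric.\<close>

lemma newton_schulz_scalar_tendsto: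
  fixes t :: real
  assumes "0 < t" "t \<le> 1"
  shows "(\<lambda>n. ((\<lambda>t. 3/2 * t - t^3/2) ^^ n) t) \<longlonglongrightarrow> 1"
proof -
  let ?x = "\<lambda>n. ((\<lambda>t. 3/2 * t - t^3/2) ^^ n) t"
  have *: "t \<le> ?x n \<and> ?x n \<le> 1 \<and> 1 - ?x n \<le> (1 - t/2) ^ n" for n
  proof (induction n)
    case 0
    then show ?case using assms by simp
  next
    case (Suc n)
    define x where "x = ?x n"
    have x: "t \<le> x" "x \<le> 1" "1 - x \<le> (1 - t/2) ^ n" using Suc by (auto simp: x_def)
    have gain: "3/2 * x - x^3/2 - x = x * (1 - x\<^sup>2) / 2"
      by (simp add: power2_eq_square power3_eq_cube field_simps)
    have "x\<^sup>2 \<le> 1" using x assms by (simp add: power_le_one)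
    then have "0 \<le> x * (1 - x\<^sup>2) / 2" using x assms by simp
    then have ge: "t \<le> 3/2 * x - x^3/2" using gain x by linarith
    have err: "1 - (3/2 * x - x^3/2) = (1 - x) * (1 - (x + x\<^sup>2) / 2)"
      by (simp add: power2_eq_square power3_eq_cube field_simps)
    have "0 \<le> (1 - x) * (1 - (x + x\<^sup>2) / 2)"
      using x \<open>x\<^sup>2 \<le> 1\<close> by simp
    then have le: "3/2 * x - x^3/2 \<le> 1" using err by linarith
    have "(1 - x) * (1 - (x + x\<^sup>2) / 2) \<le> (1 - t/2) ^ n * (1 - t/2)"
      using x \<open>x\<^sup>2 \<le> 1\<close> assms by (intro mult_mono) (auto intro: add_increasing2)
    moreover have "?x (Suc n) = 3/2 * x - x^3/2" by (simp add: x_def)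
    ultimately show ?case using ge le err by (simp add: mult.commute)
  qed
  have "(\<lambda>n. (1 - t/2) ^ n) \<longlonglongrightarrow> 0"
    using assms by (intro LIMSEQ_realpow_zero) auto
  then have "(\<lambda>n. 1 - (1 - t/2) ^ n) \<longlonglongrightarrow> 1 - 0"
    by (rule tendsto_diff[OF tendsto_const])
  then have lower: "(\<lambda>n. 1 - (1 - t/2) ^ n) \<longlonglongrightarrow> 1" by simp
  show ?thesis
    by (rule tendsto_sandwich[OF _ _ lower tendsto_const])
      (use * in \<open>auto simp: algebra_simps intro!: always_eventually\<close>)
qed

text \<open>The squared Frobenius norm is the sum of the squared singular values. Normalising by
  \<open>norm M\<close> thus puts each singular value into \<open>(0, 1]\<close>, where the scalar
  iteration tends to \<open>1\<close>.\<close>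

lemma newton_schulz_tendsto_polar_factor:
  assumes "is_polar_factor M Q"
  shows "(\<lambda>n. newton_schulz n M) \<longlonglongrightarrow> Q"
proof -
  obtain r u s v where svd: "compact_svd r u s v M" and Q: "Q = (\<Sum>i<r. 1 *\<^sub>R outer (u i) (v i))"
    using assms by (auto simp: is_polar_factor_iff_svd)
  have M: "M = (\<Sum>i<r. s i *\<^sub>R outer (u i) (v i))" and s: "\<forall>i<r. s i > 0"
    using svd by (auto simp: compact_svd_def)
  have nM: "(norm M)\<^sup>2 = (\<Sum>i<r. (s i)\<^sup>2)"
    unfolding power2_norm_eq_inner M compact_svd_inner_sum_outer[OF svd] by (simp add: power2_eq_square)
  have sM: "0 < s i / norm M" "s i / norm M \<le> 1" if "i < r" for i
  proof -
    have "(s i)\<^sup>2 \<le> (norm M)\<^sup>2"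
      unfolding nM using that by (intro member_le_sum) auto
    then have "s i \<le> norm M" by (rule power2_le_imp_le) simp
    then show "0 < s i / norm M" "s i / norm M \<le> 1"
      using s that by (auto simp: divide_simps intro: less_le_trans)
  qed
  show ?thesis
    unfolding newton_schulz_compact_svd[OF svd] Q
    by (intro tendsto_intros newton_schulz_scalar_tendsto sM) auto
qed

lemma newton_schulz_tendsto_polar: "(\<lambda>n. newton_schulz n M) \<longlonglongrightarrow> polar M"
  by (intro newton_schulz_tendsto_polar_factor is_polar_factor_polar)

lemma borel_measurable_newton_schulz: "newton_schulz n \<in> borel_measurable borel"
proof (induction n)
  case 0
  \<comment> \<open>The normalisation is discontinuous at \<open>0\<close>, so the start is treated
    by measurability; all later steps are continuous.\<close>
  show ?case unfolding newton_schulz.simps by measurable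
next
  case (Suc n)
  have "continuous_on UNIV (\<lambda>Y :: real^'n^'m. (3/2) *\<^sub>R Y - (1/2) *\<^sub>R (Y ** transpose Y ** Y))"
    unfolding matrix_matrix_mult_def transpose_def
    by (intro continuous_intros continuous_on_vec_lambda) (auto intro!: continuous_intros)
  from borel_measurable_continuous_onI[OF this] show ?case
    unfolding newton_schulz.simps using Suc by (rule measurable_compose[rotated])
qed

lemma borel_measurable_polar [measurable]: "polar \<in> borel_measurable borel"
  by (rule borel_measurable_LIMSEQ_metric[OF borel_measurable_newton_schulz newton_schulz_tendsto_polar])

section \<open>Power inequalities\<close>

text \<open>Concavity of \<open>t powr p\<close>, obtained from the weighted arithmetic-geometric
  mean inequality for \<open>t / s\<close> and \<open>1\<close>.\<close>

lemma powr_le_tangent: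
  fixes t s p :: real
  assumes "0 \<le> t" "0 < s" "0 < p" "p \<le> 1"
  shows "t powr p \<le> s powr p + p * s powr (p - 1) * (t - s)"
proof -
  have eq: "s powr p + p * s powr (p - 1) * (t - s) = s powr p * (p * (t / s) + (1 - p))"
    using assms by (simp add: powr_diff field_simps)
  show ?thesis
  proof (cases "t = 0")
    case True
    then show ?thesis using assms unfolding eq by simp
  next
    case False
    then have "(t / s) powr p * 1 powr (1 - p) \<le> p * (t / s) + (1 - p) * 1"
      using assms by (intro Youngs_inequality_0) auto
    then have "s powr p * (t / s) powr p \<le> s powr p * (p * (t / s) + (1 - p))"
      by (intro mult_left_mono) auto
    then show ?thesis unfolding eq using assms by (simp add: powr_divide)
  qed
qed

text \<open>Each of the fractions \<open>a / (a + b)\<close> and \<open>b / (a + b)\<close> is at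
  most its own \<open>p\<close>-th power, and the fractions add up to \<open>1\<close>.\<close>

lemma powr_add_le_add_powr:
  fixes a b p :: real
  assumes "0 \<le> a" "0 \<le> b" "0 < p" "p \<le> 1"
  shows "(a + b) powr p \<le> a powr p + b powr p"
proof (cases "a + b = 0")
  case True
  then show ?thesis by simp
next
  case False
  then have ab: "a + b > 0" using assms by linarith
  have *: "x / (a + b) * (a + b) powr p \<le> x powr p" if "0 \<le> x" "x \<le> a + b" for x
  proof -
    have "x / (a + b) \<le> (x / (a + b)) powr p"
      using that ab assms powr_mono'[of p 1 "x / (a + b)"] by simp
    then have "x / (a + b) * (a + b) powr p \<le> (x / (a + b)) powr p * (a + b) powr p"
      by (intro mult_right_mono) auto
    then show ?thesis using that ab by (simp add: powr_divide)
  qed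
  have "(a + b) powr p = a / (a + b) * (a + b) powr p + b / (a + b) * (a + b) powr p"
    using ab by (simp add: distrib_right[symmetric] add_divide_distrib[symmetric])
  also have "\<dots> \<le> a powr p + b powr p"
    using assms by (intro add_mono *) auto
  finally show ?thesis .
qed

text \<open>Since \<open>ln 3 \<ge> 1\<close>, convexity of the exponential gives
  \<open>3 powr (\<alpha> - 1) \<ge> \<alpha>\<close>. This is the numerical fact behind the
  constant \<open>3 powr \<alpha>\<close> in the smoothness inequality for the power of the
  norm.\<close>

lemma three_powr_ge:
  fixes \<alpha> :: real
  assumes "1 \<le> \<alpha>"
  shows "1 + 2 * \<alpha> \<le> 3 powr \<alpha>"
proof -
  have "1 \<le> ln (3::real)"
    using exp_le by (subst ln_ge_iff) auto
  then have "1 + (\<alpha> - 1) * 1 \<le> 1 + (\<alpha> - 1) * ln 3"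
    using assms by (intro add_left_mono mult_left_mono) auto
  also have "\<dots> \<le> 3 powr (\<alpha> - 1)"
    unfolding powr_def using exp_ge_add_one_self by simp
  finally have "3 * \<alpha> \<le> 3 powr \<alpha>" by (simp add: powr_diff)
  then show ?thesis using assms by linarith
qed

text \<open>A first-order expansion of \<open>norm x powr \<alpha>\<close> with remainder of order
  \<open>\<alpha>\<close> in \<open>y\<close>. For small \<open>y\<close> it comes from concavity of
  the power \<open>\<alpha>/2\<close> applied to squared norms; for large \<open>y\<close> from a
  scalar inequality in the ratio of the norms.\<close>

lemma norm_powr_add_le:
  fixes x y :: "'a::real_inner"
  assumes \<alpha>: "1 < \<alpha>" "\<alpha> \<le> 2"
  shows "norm (x + y) powr \<alpha>
    \<le> norm x powr \<alpha> + \<alpha> * norm x powr (\<alpha> - 2) * (x \<bullet> y) + 3 powr \<alpha> * norm y powr \<alpha>"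
proof -
  define a b where "a = norm x" and "b = norm y"
  have ab0: "a \<ge> 0" "b \<ge> 0" by (auto simp: a_def b_def)
  have three: "1 + 2 * \<alpha> \<le> 3 powr \<alpha>" using three_powr_ge \<alpha> by simp
  consider "x = 0" | "x \<noteq> 0" "b \<le> a" | "x \<noteq> 0" "a < b" by linarith
  then show ?thesis
  proof cases
    case 1
    have "1 * norm y powr \<alpha> \<le> 3 powr \<alpha> * norm y powr \<alpha>"
      using three \<alpha> by (intro mult_right_mono) auto
    then show ?thesis using 1 by simp
  next
    case 2
    then have a: "a > 0" by (simp add: a_def)
    have sq: "z powr \<alpha> = (z\<^sup>2) powr (\<alpha>/2)" if "z \<ge> 0" for z :: real
      using that by (simp add: powr_powr flip: powr_numeral)
    have a2: "(a\<^sup>2) powr (\<alpha>/2 - 1) = a powr (\<alpha> - 2)"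
      using a by (simp add: powr_powr algebra_simps flip: powr_numeral)
    have nxy: "(norm (x + y))\<^sup>2 - a\<^sup>2 = 2 * (x \<bullet> y) + b\<^sup>2"
      unfolding a_def b_def power2_norm_eq_inner
      by (simp add: inner_add_left inner_add_right inner_commute)
    have "norm (x + y) powr \<alpha> \<le> (a\<^sup>2) powr (\<alpha>/2) + \<alpha>/2 * (a\<^sup>2) powr (\<alpha>/2 - 1) * ((norm (x + y))\<^sup>2 - a\<^sup>2)"
      unfolding sq[OF norm_ge_zero] using a \<alpha> by (intro powr_le_tangent) auto
    also have "\<dots> = a powr \<alpha> + \<alpha> * a powr (\<alpha> - 2) * (x \<bullet> y) + \<alpha>/2 * (a powr (\<alpha> - 2) * b\<^sup>2)"
      unfolding nxy a2 sq[OF ab0(1), symmetric] by (simp add: algebra_simps)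
    also have "\<alpha>/2 * (a powr (\<alpha> - 2) * b\<^sup>2) \<le> 3 powr \<alpha> * b powr \<alpha>"
    proof (cases "b = 0")
      case False
      then have b: "b > 0" using ab0 by simp
      have "a powr (\<alpha> - 2) \<le> b powr (\<alpha> - 2)"
        \<comment> \<open>As \<open>\<alpha> - 2 \<le> 0\<close>, passing from \<open>a\<close> to
          the smaller \<open>b\<close> increases the power and turns the quadratic remainder into
          one of order \<open>\<alpha>\<close>.\<close>
        using 2 b \<alpha> by (intro powr_mono2') auto
      then have "a powr (\<alpha> - 2) * b\<^sup>2 \<le> b powr (\<alpha> - 2) * b powr 2"
        using b by (simp add: mult_right_mono)
      also have "\<dots> = b powr \<alpha>" by (subst powr_add[symmetric]) simp
      finally have "\<alpha>/2 * (a powr (\<alpha> - 2) * b\<^sup>2) \<le> 3 powr \<alpha> * b powr \<alpha>"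
        using three \<alpha> by (intro mult_mono) auto
      then show ?thesis .
    qed simp
    finally show ?thesis unfolding a_def b_def by simp
  next
    case 3
    then have a: "a > 0" by (simp add: a_def)
    with 3 have b: "b > 0" by linarith
    \<comment> \<open>By homogeneity only the ratio matters. The triangle inequality and
      Cauchy--Schwarz reduce the claim to \<open>(1 + q) powr \<alpha> \<le> q powr \<alpha> -
      \<alpha> * q powr (\<alpha> - 1) + 3 powr \<alpha>\<close> on \<open>(0, 1)\<close>.\<close>
    define q where "q = a / b"
    have q: "0 < q" "q < 1" and aq: "a = q * b" using a b 3 by (auto simp: q_def)
    have "(1 + q) powr (\<alpha> - 1) \<le> 1 powr (\<alpha> - 1) + (\<alpha> - 1) * 1 powr (\<alpha> - 1 - 1) * (1 + q - 1)"
      using q \<alpha> by (intro powr_le_tangent) auto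
    then have "(1 + q) * (1 + q) powr (\<alpha> - 1) \<le> (1 + q) * (1 + (\<alpha> - 1) * q)"
      using q by (intro mult_left_mono) auto
    moreover have "(1 + q) * (1 + q) powr (\<alpha> - 1) = (1 + q) powr \<alpha>"
      using q by (simp add: powr_diff)
    ultimately have "(1 + q) powr \<alpha> \<le> 1 + \<alpha> * q + (\<alpha> - 1) * q\<^sup>2"
      by (simp add: algebra_simps power2_eq_square)
    moreover have "q\<^sup>2 \<le> q powr \<alpha>"
      using q \<alpha> powr_mono'[of \<alpha> 2 q] by simp
    moreover have "\<alpha> * q powr (\<alpha> - 1) \<le> \<alpha> * 1"
      using q \<alpha> by (intro mult_left_mono powr_le1) auto
    moreover have "\<alpha> * q \<le> \<alpha> * 1" using q \<alpha> by (intro mult_left_mono) auto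
    moreover have "(\<alpha> - 1) * q\<^sup>2 \<le> 1 * q\<^sup>2" using \<alpha> by (intro mult_right_mono) auto
    ultimately have "(1 + q) powr \<alpha> \<le> q powr \<alpha> - \<alpha> * q powr (\<alpha> - 1) + 3 powr \<alpha>"
      using three by linarith
    then have "(1 + q) powr \<alpha> * b powr \<alpha> \<le> (q powr \<alpha> - \<alpha> * q powr (\<alpha> - 1) + 3 powr \<alpha>) * b powr \<alpha>"
      by (intro mult_right_mono) auto
    moreover have "(1 + q) powr \<alpha> * b powr \<alpha> = (a + b) powr \<alpha>"
      using q b by (simp add: aq powr_mult[symmetric] algebra_simps)
    moreover have "q powr \<alpha> * b powr \<alpha> = a powr \<alpha>"
      using q b by (simp add: aq powr_mult)
    moreover have "q powr (\<alpha> - 1) * b powr \<alpha> = a powr (\<alpha> - 2) * (a * b)"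
    proof -
      have "b powr \<alpha> = b powr (\<alpha> - 1) * b" "a powr (\<alpha> - 1) = a powr (\<alpha> - 2) * a"
        using a b by (simp_all add: powr_diff power2_eq_square)
      moreover have "q powr (\<alpha> - 1) * b powr (\<alpha> - 1) = a powr (\<alpha> - 1)"
        using q b by (simp add: aq powr_mult)
      ultimately show ?thesis by (metis mult.assoc)
    qed
    ultimately have "(a + b) powr \<alpha> \<le> a powr \<alpha> - \<alpha> * (a powr (\<alpha> - 2) * (a * b)) + 3 powr \<alpha> * b powr \<alpha>"
      by (simp add: algebra_simps)
    moreover have "norm (x + y) powr \<alpha> \<le> (a + b) powr \<alpha>"
      unfolding a_def b_def using \<alpha> by (intro powr_mono2 norm_triangle_ineq) auto
    moreover have "- (a * b) \<le> x \<bullet> y"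
      using Cauchy_Schwarz_ineq2[of x y] by (simp add: a_def b_def)
    then have "\<alpha> * a powr (\<alpha> - 2) * (- (a * b)) \<le> \<alpha> * a powr (\<alpha> - 2) * (x \<bullet> y)"
      using \<alpha> by (intro mult_left_mono) auto
    ultimately show ?thesis unfolding a_def[symmetric] b_def[symmetric] by (simp add: algebra_simps)
  qed
qed

text \<open>A Young inequality without sharp constants, from replacing both numbers by their
  maximum; it serves to show that the cross terms are integrable.\<close>

lemma mult_powr_le_powr_add:
  fixes a b \<alpha> :: real
  assumes "0 \<le> a" "0 \<le> b" "1 < \<alpha>"
  shows "a powr (\<alpha> - 1) * b \<le> a powr \<alpha> + b powr \<alpha>"
proof -
  have *: "z powr (\<alpha> - 1) * z = z powr \<alpha>" if "z \<ge> 0" for z :: real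
    using that by (cases "z = 0") (auto simp: powr_diff)
  have "a powr (\<alpha> - 1) * b \<le> (max a b) powr (\<alpha> - 1) * max a b"
    using assms by (intro mult_mono powr_mono2) auto
  also have "\<dots> = (max a b) powr \<alpha>" using assms by (intro *) auto
  also have "\<dots> \<le> a powr \<alpha> + b powr \<alpha>" by (auto simp: max_def)
  finally show ?thesis .
qed

lemma add_powr_le:
  fixes a b \<alpha> :: real
  assumes "0 \<le> a" "0 \<le> b" "0 < \<alpha>"
  shows "(a + b) powr \<alpha> \<le> 2 powr \<alpha> * (a powr \<alpha> + b powr \<alpha>)"
proof -
  have "(a + b) powr \<alpha> \<le> (2 * max a b) powr \<alpha>"
    using assms by (intro powr_mono2) auto
  also have "\<dots> = 2 powr \<alpha> * (max a b) powr \<alpha>"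
    using assms by (simp add: powr_mult)
  also have "\<dots> \<le> 2 powr \<alpha> * (a powr \<alpha> + b powr \<alpha>)"
    by (intro mult_left_mono) (auto simp: max_def)
  finally show ?thesis .
qed

section \<open>Weighted sums of heavy-tailed batch noise\<close>

text \<open>
  \<open>D k\<close> plays the role of the gradient at the \<open>k\<close>-th iterate; it is bounded because every Muon step
  has bounded length.
\<close>

locale heavy_tailed_batches = prob_space P for P :: "'w measure" +
  fixes F :: "nat \<Rightarrow> 'w measure"
    and G :: "nat \<Rightarrow> nat \<Rightarrow> 'w \<Rightarrow> 'a::euclidean_space"
    and D :: "nat \<Rightarrow> 'w \<Rightarrow> 'a"
    and B :: nat and \<alpha> \<sigma>0 \<sigma>1 :: real
  assumes \<alpha>: "1 < \<alpha>" "\<alpha> \<le> 2"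
    and \<sigma>: "0 \<le> \<sigma>0" "0 \<le> \<sigma>1"
    and F_sub: "\<And>k. subalgebra P (F k)"
    and F_mono: "\<And>k. sets (F k) \<subseteq> sets (F (Suc k))"
    and D_meas: "\<And>k. D k \<in> borel_measurable (F k)"
    and D_bounded: "\<And>k. \<exists>c. \<forall>w. norm (D k w) \<le> c"
    and G_meas: "\<And>k i. i \<in> {1..B} \<Longrightarrow> G k i \<in> borel_measurable (F (Suc k))"
    and G_indep: "\<And>k (A :: nat \<Rightarrow> 'a set). (\<And>i. A i \<in> sets borel) \<Longrightarrow>
         AE w in P. real_cond_exp P (F k) (\<lambda>w. \<Prod>i\<in>{1..B}. indicator (A i) (G k i w)) w
                   = (\<Prod>i\<in>{1..B}. real_cond_exp P (F k) (\<lambda>w. indicator (A i) (G k i w)) w)"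
    and G_unbiased: "\<And>k i b. i \<in> {1..B} \<Longrightarrow> b \<in> Basis \<Longrightarrow>
         AE w in P. real_cond_exp P (F k) (\<lambda>w. G k i w \<bullet> b) w = D k w \<bullet> b"
    and G_moment: "\<And>k i. i \<in> {1..B} \<Longrightarrow>
         AE w in P. nn_cond_exp P (F k) (\<lambda>w. ennreal (norm (G k i w - D k w) powr \<alpha>)) w
                   \<le> ennreal (\<sigma>0 powr \<alpha> + \<sigma>1 powr \<alpha> * norm (D k w) powr \<alpha>)"
begin

section \<open>Moments and integrability of the noise\<close>

definition noise :: "nat \<Rightarrow> nat \<Rightarrow> 'w \<Rightarrow> 'a" where
  "noise k i w = G k i w - D k w"

definition moment_bound :: "nat \<Rightarrow> 'w \<Rightarrow> real" where
  "moment_bound k w = \<sigma>0 powr \<alpha> + \<sigma>1 powr \<alpha> * norm (D k w) powr \<alpha>"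

lemma finite_measure_subalgebra_F: "finite_measure_subalgebra P (F k)"
  using F_sub by unfold_locales

lemma D_measurable_P [measurable]: "D k \<in> borel_measurable P"
  using measurable_from_subalg[OF F_sub D_meas] .

lemma G_measurable_P [measurable]: "i \<in> {1..B} \<Longrightarrow> G k i \<in> borel_measurable P"
  using measurable_from_subalg[OF F_sub G_meas] .

lemma noise_measurable_P [measurable]: "i \<in> {1..B} \<Longrightarrow> noise k i \<in> borel_measurable P"
  unfolding noise_def by measurable

lemma moment_bound_nonneg: "0 \<le> moment_bound k w"
  by (simp add: moment_bound_def)

lemma moment_bound_measurable [measurable]: "moment_bound k \<in> borel_measurable (F k)"
  unfolding moment_bound_def using D_meas[of k] by measurable

lemma moment_bound_measurable_P [measurable]: "moment_bound k \<in> borel_measurable P"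
  using measurable_from_subalg[OF F_sub moment_bound_measurable] .

lemma moment_bound_bounded: "\<exists>c. \<forall>w. moment_bound k w \<le> c"
proof -
  obtain c where "norm (D k w) \<le> c" for w using D_bounded by blast
  then have "moment_bound k w \<le> \<sigma>0 powr \<alpha> + \<sigma>1 powr \<alpha> * c powr \<alpha>" for w
    unfolding moment_bound_def using \<alpha>
    by (intro add_left_mono mult_left_mono powr_mono2) auto
  then show ?thesis by blast
qed

lemma integrable_bounded:
  fixes f :: "'w \<Rightarrow> 'b::{banach, second_countable_topology}"
  assumes "f \<in> borel_measurable P" "\<And>w. norm (f w) \<le> c"
  shows "integrable P f"
  using assms by (intro integrable_const_bound[of _ c]) auto

lemma integrable_D: "integrable P (D k)"
  using D_bounded[of k] integrable_bounded by (metis D_measurable_P)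

text \<open>A weight measurable with respect to \<open>F k\<close> moves through the conditional
  expectation. Nonnegative integrals are used because finiteness of the \<open>\<alpha>\<close>-th
  moment is itself derived from this bound.\<close>

lemma nn_integral_noise_powr_le:
  assumes "i \<in> {1..B}" "W \<in> borel_measurable (F k)"
  shows "(\<integral>\<^sup>+ w. ennreal (W w) * ennreal (norm (noise k i w) powr \<alpha>) \<partial>P)
    \<le> (\<integral>\<^sup>+ w. ennreal (W w) * ennreal (moment_bound k w) \<partial>P)"
proof -
  interpret Fk: finite_measure_subalgebra P "F k" by (rule finite_measure_subalgebra_F)
  have [measurable]: "noise k i \<in> borel_measurable P" using assms(1) by measurable
  have "(\<integral>\<^sup>+ w. ennreal (W w) * ennreal (norm (noise k i w) powr \<alpha>) \<partial>P)
      = (\<integral>\<^sup>+ w. ennreal (W w) * nn_cond_exp P (F k) (\<lambda>w. ennreal (norm (noise k i w) powr \<alpha>)) w \<partial>P)"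
    using assms(2) by (subst Fk.nn_cond_exp_intg) auto
  also have "\<dots> \<le> (\<integral>\<^sup>+ w. ennreal (W w) * ennreal (moment_bound k w) \<partial>P)"
  proof (rule nn_integral_mono_AE)
    show "AE w in P. ennreal (W w) * nn_cond_exp P (F k) (\<lambda>w. ennreal (norm (noise k i w) powr \<alpha>)) w
        \<le> ennreal (W w) * ennreal (moment_bound k w)"
      using G_moment[OF assms(1), of k] unfolding noise_def moment_bound_def
      by eventually_elim (rule mult_left_mono, auto)
  qed
  finally show ?thesis .
qed

lemma integrable_noise_powr:
  assumes "i \<in> {1..B}"
  shows "integrable P (\<lambda>w. norm (noise k i w) powr \<alpha>)"
proof (rule integrableI_bounded)
  have [measurable]: "noise k i \<in> borel_measurable P" using assms(1) by measurable
  show "(\<lambda>w. norm (noise k i w) powr \<alpha>) \<in> borel_measurable P" by measurable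
  obtain c where c: "moment_bound k w \<le> c" for w using moment_bound_bounded by blast
  have "(\<integral>\<^sup>+ w. ennreal (norm (noise k i w) powr \<alpha>) \<partial>P) \<le> (\<integral>\<^sup>+ w. ennreal (moment_bound k w) \<partial>P)"
    using nn_integral_noise_powr_le[OF assms, of "\<lambda>_. 1" k] by simp
  also have "\<dots> \<le> (\<integral>\<^sup>+ w. ennreal c \<partial>P)"
    using c by (intro nn_integral_mono) (auto intro: ennreal_leI)
  also have "\<dots> < \<infinity>" by (simp add: emeasure_space_1)
  finally show "(\<integral>\<^sup>+ w. ennreal (norm (norm (noise k i w) powr \<alpha>)) \<partial>P) < \<infinity>" by simp
qed

lemma integral_noise_powr_le:
  assumes "i \<in> {1..B}" "W \<in> borel_measurable (F k)" "\<And>w. 0 \<le> W w" "\<And>w. W w \<le> c"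
  shows "(\<integral>w. W w * norm (noise k i w) powr \<alpha> \<partial>P) \<le> (\<integral>w. W w * moment_bound k w \<partial>P)"
proof -
  have W[measurable]: "W \<in> borel_measurable P"
    using measurable_from_subalg[OF F_sub assms(2)] .
  have [measurable]: "noise k i \<in> borel_measurable P" using assms(1) by measurable
  have Wc: "norm (W w) \<le> c" for w using assms(3,4)[of w] by simp
  obtain c' where c': "moment_bound k w \<le> c'" for w using moment_bound_bounded by blast
  have c0: "0 \<le> c" using assms(3,4) order_trans by blast
  have int2: "integrable P (\<lambda>w. W w * moment_bound k w)"
    using assms(3,4) c' c0 moment_bound_nonneg
    by (intro integrable_bounded[of _ "c * c'"]) (auto simp: abs_mult intro!: mult_mono)
  have int1: "integrable P (\<lambda>w. W w * norm (noise k i w) powr \<alpha>)"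
    using Wc
    by (intro Bochner_Integration.integrable_bound[OF integrable_mult_right[OF integrable_noise_powr[OF assms(1), of k], of c]])
      (auto simp: abs_mult intro!: mult_right_mono order_trans[OF _ abs_ge_self])
  have "ennreal (\<integral>w. W w * norm (noise k i w) powr \<alpha> \<partial>P) \<le> ennreal (\<integral>w. W w * moment_bound k w \<partial>P)"
    using nn_integral_noise_powr_le[OF assms(1,2)] assms(3) moment_bound_nonneg
    by (simp add: nn_integral_eq_integral[symmetric] int1 int2 ennreal_mult)
  then show ?thesis
    using assms(3) moment_bound_nonneg by (subst (asm) ennreal_le_iff) (auto intro!: integral_nonneg)
qed

lemma integrable_noise:
  assumes "i \<in> {1..B}"
  shows "integrable P (noise k i)"
proof -
  have "norm (noise k i w) \<le> 1 + norm (noise k i w) powr \<alpha>" for w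
  proof (cases "norm (noise k i w) \<le> 1")
    case False
    then have "norm (noise k i w) powr 1 \<le> norm (noise k i w) powr \<alpha>"
      using \<alpha> by (intro powr_mono) auto
    then show ?thesis using False by simp
  qed (simp add: add_increasing2)
  then have "AE w in P. norm (noise k i w) \<le> norm (1 + norm (noise k i w) powr \<alpha>)"
    by simp
  moreover have "integrable P (\<lambda>w. 1 + norm (noise k i w) powr \<alpha>)"
    using integrable_noise_powr[OF assms] by simp
  ultimately show ?thesis
    using noise_measurable_P[OF assms] Bochner_Integration.integrable_bound by blast
qed

lemma integrable_G:
  assumes "i \<in> {1..B}"
  shows "integrable P (G k i)"
proof -
  have "G k i = (\<lambda>w. noise k i w + D k w)" by (simp add: noise_def fun_eq_iff)
  then show ?thesis using integrable_noise[OF assms] integrable_D by simp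
qed

section \<open>Conditional independence within one batch\<close>

definition past :: "nat \<Rightarrow> nat \<Rightarrow> (nat \<Rightarrow> 'a set) \<Rightarrow> 'w \<Rightarrow> real" where
  "past k i A w = (\<Prod>j\<in>{1..<i}. indicator (A j) (G k j w))"

lemma past_bounds: "0 \<le> past k i A w" "past k i A w \<le> 1"
  unfolding past_def by (auto intro!: prod_nonneg prod_le_1 simp: indicator_def)

lemma past_measurable:
  assumes "i \<in> {1..B}" "\<And>j. A j \<in> sets borel"
  shows "past k i A \<in> borel_measurable P"
  unfolding past_def
proof (rule borel_measurable_prod)
  fix j assume "j \<in> {1..<i}"
  then have [measurable]: "G k j \<in> borel_measurable P" using assms(1) by auto
  have [measurable]: "A j \<in> sets borel" by (rule assms(2))
  show "(\<lambda>w. indicator (A j) (G k j w) :: real) \<in> borel_measurable P" by measurable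
qed

text \<open>Two instances of the product formula are compared, one with \<open>A'\<close> and one
  with \<open>UNIV\<close> for sample \<open>i\<close>; the second identifies the conditional
  expectation of \<open>past k i A\<close> with the product over the earlier samples.\<close>

lemma cond_exp_past_mult_indicator:
  assumes i: "i \<in> {1..B}" and A: "\<And>j. A j \<in> sets borel" and A': "A' \<in> sets borel"
  shows "AE w in P. real_cond_exp P (F k) (\<lambda>w. past k i A w * indicator A' (G k i w)) w
     = real_cond_exp P (F k) (past k i A) w * real_cond_exp P (F k) (\<lambda>w. indicator A' (G k i w)) w"
proof -
  interpret Fk: finite_measure_subalgebra P "F k" by (rule finite_measure_subalgebra_F)
  have one: "AE w in P. real_cond_exp P (F k) (\<lambda>w. 1) w = 1"
    by (rule Fk.real_cond_exp_F_meas) auto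
  have split: "{1..B} = {1..<i} \<union> {i} \<union> {i<..B}" using i by auto
  have prod_split: "(\<Prod>j\<in>{1..B}. g j) = (\<Prod>j\<in>{1..<i}. g j) * g i * (\<Prod>j\<in>{i<..B}. g j)" for g :: "nat \<Rightarrow> real"
    unfolding split by (subst prod.union_disjoint; (subst prod.union_disjoint)?) auto
  have key: "AE w in P. real_cond_exp P (F k) (\<lambda>w. past k i A w * indicator C (G k i w)) w
     = (\<Prod>j\<in>{1..<i}. real_cond_exp P (F k) (\<lambda>w. indicator (A j) (G k j w)) w)
         * real_cond_exp P (F k) (\<lambda>w. indicator C (G k i w)) w"
    if C: "C \<in> sets borel" for C
  proof -
    \<comment> \<open>Samples after \<open>i\<close> receive \<open>UNIV\<close>, whose indicator
      has conditional expectation \<open>1\<close> and drops out of the product.\<close>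
    define A2 where "A2 j = (if j < i then A j else if j = i then C else UNIV)" for j
    have "A2 j \<in> sets borel" for j using A C by (simp add: A2_def)
    from G_indep[where A = A2, OF this, of k] one show ?thesis
    proof eventually_elim
      case (elim w)
      have "(\<lambda>w. \<Prod>j\<in>{1..B}. indicator (A2 j) (G k j w)) = (\<lambda>w. past k i A w * indicator C (G k i w) :: real)"
        unfolding prod_split past_def by (simp add: A2_def)
      moreover have "(\<Prod>j\<in>{1..B}. real_cond_exp P (F k) (\<lambda>w. indicator (A2 j) (G k j w)) w)
        = (\<Prod>j\<in>{1..<i}. real_cond_exp P (F k) (\<lambda>w. indicator (A j) (G k j w)) w)
         * real_cond_exp P (F k) (\<lambda>w. indicator C (G k i w)) w"
        unfolding prod_split using elim(2) by (simp add: A2_def)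
      ultimately show ?case using elim(1) by simp
    qed
  qed
  have "AE w in P. real_cond_exp P (F k) (past k i A) w
     = (\<Prod>j\<in>{1..<i}. real_cond_exp P (F k) (\<lambda>w. indicator (A j) (G k j w)) w)"
  proof -
    have "AE w in P. real_cond_exp P (F k) (past k i A) w
       = (\<Prod>j\<in>{1..<i}. real_cond_exp P (F k) (\<lambda>w. indicator (A j) (G k j w)) w)
           * real_cond_exp P (F k) (\<lambda>w. 1) w"
      using key[of UNIV] by simp
    then show ?thesis using one by eventually_elim simp
  qed
  then show ?thesis
    using key[OF A'] by eventually_elim simp
qed

text \<open>
  By conditional independence, \<open>past k i A\<close> may be replaced by its conditional expectation \<open>q\<close> when
  it is integrated against events generated by \<open>G k i\<close>, hence against \<open>G k i\<close> itself; \<open>q\<close> is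
  measurable with respect to \<open>F k\<close>, so unbiasedness applies.
\<close>

lemma integral_past_noise_eq_0:
  assumes i: "i \<in> {1..B}" and A: "\<And>j. A j \<in> sets borel" and E: "E \<in> sets (F k)" and b: "b \<in> Basis"
  shows "(\<integral>w. indicator E w * past k i A w * (noise k i w \<bullet> b) \<partial>P) = 0"
proof -
  interpret Fk: finite_measure_subalgebra P "F k" by (rule finite_measure_subalgebra_F)
  \<comment> \<open>\<open>N\<close> is generated by the sample \<open>G k i\<close>; agreement of
    integrals over all events of this sample is agreement of conditional expectations given
    \<open>N\<close>.\<close>
  define N where "N = vimage_algebra (space P) (G k i) borel"
  have Gm[measurable]: "G k i \<in> borel_measurable P" using i by measurable
  have N: "subalgebra P N"
    unfolding N_def subalgebra_def using Gm by (auto simp: sets_vimage_algebra2 measurable_sets)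
  interpret N: finite_measure_subalgebra P N using N by unfold_locales
  have GN: "G k i \<in> borel_measurable N" unfolding N_def by (rule measurable_vimage_algebra1) auto
  define d q where "d = past k i A" and "q = real_cond_exp P (F k) d"
  have [measurable]: "E \<in> sets P" using E F_sub[of k] by (auto simp: subalgebra_def)
  have d[measurable]: "d \<in> borel_measurable P" unfolding d_def using past_measurable[OF i A] .
  have d01: "0 \<le> d w" "d w \<le> 1" for w using past_bounds by (auto simp: d_def)
  have dint: "integrable P d" using d01 by (intro integrable_bounded[of _ 1]) auto
  have qF: "q \<in> borel_measurable (F k)" unfolding q_def by measurable
  then have q[measurable]: "q \<in> borel_measurable P" by (rule measurable_from_subalg[OF F_sub])
  have "AE w in P. 0 \<le> q w" "AE w in P. q w \<le> 1"
    unfolding q_def using d01 dint by (auto intro!: Fk.real_cond_exp_ge_c Fk.real_cond_exp_le_c)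
  then have qb: "AE w in P. \<bar>q w\<bar> \<le> 1" by eventually_elim simp
  have EF: "(\<lambda>w. indicator E w :: real) \<in> borel_measurable (F k)" using E by measurable
  have small: "integrable P (\<lambda>w. f w * g w)"
    if "integrable P g" "f \<in> borel_measurable P" "AE w in P. \<bar>f w\<bar> \<le> 1" for f g :: "'w \<Rightarrow> real"
  proof (rule Bochner_Integration.integrable_bound[OF that(1)])
    show "(\<lambda>w. f w * g w) \<in> borel_measurable P" using that by measurable
    show "AE w in P. norm (f w * g w) \<le> norm (g w)"
      using that(3) by eventually_elim (auto simp: abs_mult intro: mult_left_le_one_le)
  qed
  have Ed: "AE w in P. \<bar>indicator E w * d w\<bar> \<le> 1" using d01 by (auto simp: indicator_def)
  have Eq: "AE w in P. \<bar>indicator E w * q w\<bar> \<le> 1" using qb by eventually_elim (auto simp: indicator_def)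
  \<comment> \<open>Conditional independence enters here: against an event of \<open>G k i\<close>,
    the earlier samples act only through \<open>q\<close>.\<close>
  have sets_eq: "(\<integral>w. indicator E w * d w * indicator A' (G k i w) \<partial>P)
      = (\<integral>w. indicator E w * q w * indicator A' (G k i w) \<partial>P)" if A': "A' \<in> sets borel" for A'
  proof -
    have [measurable]: "(\<lambda>w. indicator A' (G k i w) :: real) \<in> borel_measurable P"
      using A' by measurable
    have ind: "integrable P (\<lambda>w. indicator A' (G k i w) :: real)"
      by (intro integrable_bounded[of _ 1]) auto
    have "(\<integral>w. indicator E w * d w * indicator A' (G k i w) \<partial>P)
       = (\<integral>w. indicator E w * real_cond_exp P (F k) (\<lambda>w. d w * indicator A' (G k i w)) w \<partial>P)"
      using EF small[OF ind _ Ed] by (subst Fk.real_cond_exp_intg(2)) (auto simp: mult.assoc)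
    also have "\<dots> = (\<integral>w. indicator E w * q w * real_cond_exp P (F k) (\<lambda>w. indicator A' (G k i w)) w \<partial>P)"
    proof (rule integral_cong_AE)
      show "AE w in P. indicator E w * real_cond_exp P (F k) (\<lambda>w. d w * indicator A' (G k i w)) w
         = indicator E w * q w * real_cond_exp P (F k) (\<lambda>w. indicator A' (G k i w)) w"
        using cond_exp_past_mult_indicator[where A = A, OF i A A', of k] unfolding d_def q_def
        by eventually_elim simp
    qed measurable
    also have "\<dots> = (\<integral>w. indicator E w * q w * indicator A' (G k i w) \<partial>P)"
      using EF qF small[OF ind _ Eq] by (subst Fk.real_cond_exp_intg(2)) auto
    finally show ?thesis .
  qed
  have "AE w in P. real_cond_exp P N (\<lambda>w. indicator E w * d w) w = real_cond_exp P N (\<lambda>w. indicator E w * q w) w"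
  proof (rule N.real_cond_exp_charact)
    show i1: "integrable P (\<lambda>w. indicator E w * d w)"
      using small[of "\<lambda>_. 1", OF _ _ Ed] by simp
    have i2: "integrable P (\<lambda>w. indicator E w * q w)"
      using small[of "\<lambda>_. 1", OF _ _ Eq] by simp
    then show "integrable P (real_cond_exp P N (\<lambda>w. indicator E w * q w))" by (rule N.real_cond_exp_int)
    fix C assume C: "C \<in> sets N"
    then obtain A' where A': "A' \<in> sets borel" "C = G k i -` A' \<inter> space P"
      by (auto simp: N_def sets_vimage_algebra2)
    have *: "(\<integral>w\<in>C. f w \<partial>P) = (\<integral>w. f w * indicator A' (G k i w) \<partial>P)" for f :: "'w \<Rightarrow> real"
      unfolding set_lebesgue_integral_def
      by (intro Bochner_Integration.integral_cong) (auto simp: A' indicator_def)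
    show "(\<integral>w\<in>C. indicator E w * d w \<partial>P) = (\<integral>w\<in>C. real_cond_exp P N (\<lambda>w. indicator E w * q w) w \<partial>P)"
      using N.real_cond_exp_intA[OF i2 C] sets_eq[OF A'(1)] unfolding * by simp
  qed measurable
  note cond_eq = this
  have Gb: "integrable P (\<lambda>w. G k i w \<bullet> b)" using integrable_G[OF i] by simp
  have Db: "integrable P (\<lambda>w. D k w \<bullet> b)" using integrable_D by simp
  have GbN: "(\<lambda>w. G k i w \<bullet> b) \<in> borel_measurable N" using GN by measurable
  have "(\<integral>w. indicator E w * d w * (G k i w \<bullet> b) \<partial>P) = (\<integral>w. (G k i w \<bullet> b) * (indicator E w * d w) \<partial>P)"
    by (simp add: mult.commute)
  also have "\<dots> = (\<integral>w. (G k i w \<bullet> b) * real_cond_exp P N (\<lambda>w. indicator E w * d w) w \<partial>P)"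
    using small[OF Gb _ Ed] GbN by (subst N.real_cond_exp_intg(2)) (auto simp: mult.commute)
  also have "\<dots> = (\<integral>w. (G k i w \<bullet> b) * real_cond_exp P N (\<lambda>w. indicator E w * q w) w \<partial>P)"
    using cond_eq by (intro integral_cong_AE) auto
  also have "\<dots> = (\<integral>w. (G k i w \<bullet> b) * (indicator E w * q w) \<partial>P)"
    using small[OF Gb _ Eq] GbN by (subst N.real_cond_exp_intg(2)) (auto simp: mult.commute)
  also have "\<dots> = (\<integral>w. indicator E w * q w * (G k i w \<bullet> b) \<partial>P)"
    by (simp add: mult.commute)
  also have "\<dots> = (\<integral>w. indicator E w * q w * real_cond_exp P (F k) (\<lambda>w. G k i w \<bullet> b) w \<partial>P)"
    using EF qF small[OF Gb _ Eq] by (subst Fk.real_cond_exp_intg(2)) auto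
  also have "\<dots> = (\<integral>w. indicator E w * (D k w \<bullet> b) * q w \<partial>P)"
    using G_unbiased[OF i b, of k] by (intro integral_cong_AE) auto
  \<comment> \<open>Once the sample has been replaced by \<open>D k\<close>, the integrand apart
    from \<open>q\<close> is measurable for \<open>F k\<close>, and \<open>q\<close> can be turned
    back into \<open>d\<close>.\<close>
  also have "\<dots> = (\<integral>w. indicator E w * (D k w \<bullet> b) * d w \<partial>P)"
    unfolding q_def using EF D_meas[of k] small[OF Db _ Ed]
    by (subst Fk.real_cond_exp_intg(2)) (auto simp: mult_ac)
  also have "\<dots> = (\<integral>w. indicator E w * d w * (D k w \<bullet> b) \<partial>P)"
    by (simp add: mult_ac)
  finally have "(\<integral>w. indicator E w * d w * (G k i w \<bullet> b) \<partial>P) = (\<integral>w. indicator E w * d w * (D k w \<bullet> b) \<partial>P)" .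
  moreover have "(\<integral>w. indicator E w * d w * (noise k i w \<bullet> b) \<partial>P)
     = (\<integral>w. indicator E w * d w * (G k i w \<bullet> b) - indicator E w * d w * (D k w \<bullet> b) \<partial>P)"
    by (simp add: noise_def inner_diff_left right_diff_distrib)
  moreover have "\<dots> = (\<integral>w. indicator E w * d w * (G k i w \<bullet> b) \<partial>P) - (\<integral>w. indicator E w * d w * (D k w \<bullet> b) \<partial>P)"
    by (rule Bochner_Integration.integral_diff) (auto intro!: small Gb Db Ed)
  ultimately show ?thesis by (simp add: d_def)
qed

text \<open>\<open>history k i\<close> is the \<open>\<sigma>\<close>-algebra generated by \<open>F k\<close> and the samples \<open>G k 1, \<dots>, G k (i - 1)\<close>.\<close>

definition history_events :: "nat \<Rightarrow> nat \<Rightarrow> 'w set set" where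
  "history_events k i =
     {E \<inter> {w \<in> space P. \<forall>j\<in>{1..<i}. G k j w \<in> A j} | E A. E \<in> sets (F k) \<and> (\<forall>j. A j \<in> sets borel)}"

definition history :: "nat \<Rightarrow> nat \<Rightarrow> 'w measure" where
  "history k i = sigma (space P) (history_events k i)"

lemma history_eventsI:
  "E \<in> sets (F k) \<Longrightarrow> (\<And>j. A j \<in> sets borel) \<Longrightarrow>
    E \<inter> {w \<in> space P. \<forall>j\<in>{1..<i}. G k j w \<in> A j} \<in> history_events k i"
  unfolding history_events_def by blast

lemma history_events_closed: "history_events k i \<subseteq> Pow (space P)"
  unfolding history_events_def by auto

lemma space_history [simp]: "space (history k i) = space P"
  by (simp add: history_def history_events_closed space_measure_of)

lemma sets_history: "sets (history k i) = sigma_sets (space P) (history_events k i)"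
  by (simp add: history_def history_events_closed sets_measure_of)

lemma Int_stable_history_events: "Int_stable (history_events k i)"
proof (rule Int_stableI)
  fix a b assume "a \<in> history_events k i" "b \<in> history_events k i"
  then obtain E A E' A' where *: "E \<in> sets (F k)" "\<forall>j. A j \<in> sets borel" "E' \<in> sets (F k)" "\<forall>j. A' j \<in> sets borel"
    "a = E \<inter> {w \<in> space P. \<forall>j\<in>{1..<i}. G k j w \<in> A j}"
    "b = E' \<inter> {w \<in> space P. \<forall>j\<in>{1..<i}. G k j w \<in> A' j}"
    unfolding history_events_def by blast
  have "a \<inter> b = (E \<inter> E') \<inter> {w \<in> space P. \<forall>j\<in>{1..<i}. G k j w \<in> A j \<inter> A' j}"
    using * by auto
  also have "\<dots> \<in> history_events k i"
    using * by (intro history_eventsI) auto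
  finally show "a \<inter> b \<in> history_events k i" .
qed

lemma subalgebra_history:
  assumes "i \<in> {1..B}"
  shows "subalgebra P (history k i)"
  unfolding subalgebra_def sets_history
proof (intro conjI sets.sigma_sets_subset subsetI)
  fix a assume "a \<in> history_events k i"
  then obtain E A where *: "E \<in> sets (F k)" "\<forall>j. A j \<in> sets borel"
    "a = E \<inter> {w \<in> space P. \<forall>j\<in>{1..<i}. G k j w \<in> A j}"
    unfolding history_events_def by blast
  have "E \<in> sets P" using * F_sub[of k] by (auto simp: subalgebra_def)
  moreover have "{w \<in> space P. \<forall>j\<in>{1..<i}. G k j w \<in> A j} \<in> sets P"
  proof (rule sets.sets_Collect_finite_All)
    fix j assume "j \<in> {1..<i}"
    then have [measurable]: "G k j \<in> borel_measurable P" using assms by auto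
    have [measurable]: "A j \<in> sets borel" using * by simp
    show "{w \<in> space P. G k j w \<in> A j} \<in> sets P" by measurable
  qed auto
  ultimately show "a \<in> sets P" using * by auto
qed simp

lemma F_subset_history: "sets (F k) \<subseteq> sets (history k i)"
proof
  fix E assume E: "E \<in> sets (F k)"
  then have "E \<subseteq> space P" using F_sub[of k] sets.sets_into_space by (fastforce simp: subalgebra_def)
  then have "E = E \<inter> {w \<in> space P. \<forall>j\<in>{1..<i}. G k j w \<in> (\<lambda>_. UNIV) j}" by auto
  also have "\<dots> \<in> history_events k i" using E by (intro history_eventsI) auto
  finally show "E \<in> sets (history k i)" by (simp add: sets_history)
qed

lemma measurable_history_F: "f \<in> measurable (F k) N \<Longrightarrow> f \<in> measurable (history k i) N"
  using F_subset_history F_sub[of k]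
  by (intro measurable_from_subalg[of "history k i" "F k"]) (auto simp: subalgebra_def)

lemma measurable_history_G:
  assumes "j \<in> {1..<i}"
  shows "G k j \<in> borel_measurable (history k i)"
proof (rule measurableI)
  fix C :: "'a set" assume C: "C \<in> sets borel"
  have "G k j -` C \<inter> space (history k i)
     = space P \<inter> {w \<in> space P. \<forall>l\<in>{1..<i}. G k l w \<in> (if l = j then C else UNIV)}"
    using assms by auto
  also have "\<dots> \<in> history_events k i"
    using C F_sub[of k] sets.top[of "F k"] by (intro history_eventsI) (auto simp: subalgebra_def)
  finally show "G k j -` C \<inter> space (history k i) \<in> sets (history k i)" by (simp add: sets_history)
qed simp

text \<open>Dynkin's argument: the events in \<open>history_events\<close> are stable under
  intersection and generate \<open>history k i\<close>, and the vanishing of the integral passes to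
  complements and countable disjoint unions.\<close>

lemma set_integral_history_event_noise_eq_0:
  assumes i: "i \<in> {1..B}" and b: "b \<in> Basis" and C: "C \<in> sets (history k i)"
  shows "(\<integral>w\<in>C. (noise k i w \<bullet> b) \<partial>P) = 0"
proof -
  have int: "integrable P (\<lambda>w. noise k i w \<bullet> b)" using integrable_noise[OF i] by simp
  have sub: "sets (history k i) \<subseteq> sets P" using subalgebra_history[OF i] by (auto simp: subalgebra_def)
  have sint: "set_integrable P C (\<lambda>w. noise k i w \<bullet> b)" if "C \<in> sets P" for C
    using that int unfolding set_integrable_def by (rule integrable_mult_indicator)
  have event: "(\<integral>w\<in>C. (noise k i w \<bullet> b) \<partial>P) = 0" if ev: "C \<in> history_events k i" for C
  proof -
    obtain E A where *: "E \<in> sets (F k)" "\<forall>j. A j \<in> sets borel"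
      "C = E \<inter> {w \<in> space P. \<forall>j\<in>{1..<i}. G k j w \<in> A j}"
      using ev unfolding history_events_def by blast
    have "past k i A w = (if \<forall>j\<in>{1..<i}. G k j w \<in> A j then 1 else 0)" for w
      unfolding past_def by (auto simp: indicator_def intro!: prod.neutral)
    then have "indicator C w = indicator E w * past k i A w" if "w \<in> space P" for w
      using that by (auto simp: * indicator_def)
    then have "(\<integral>w\<in>C. (noise k i w \<bullet> b) \<partial>P) = (\<integral>w. indicator E w * past k i A w * (noise k i w \<bullet> b) \<partial>P)"
      unfolding set_lebesgue_integral_def by (intro Bochner_Integration.integral_cong) auto
    then show ?thesis using integral_past_noise_eq_0[where A = A, OF i _ *(1) b] *(2) by simp
  qed
  have "C \<in> sigma_sets (space P) (history_events k i)" using C by (simp add: sets_history)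
  with Int_stable_history_events history_events_closed show ?thesis
  proof (induction rule: sigma_sets_induct_disjoint)
    case (basic A)
    then show ?case by (rule event)
  next
    case empty
    show ?case by (simp add: set_lebesgue_integral_def)
  next
    case (compl A)
    then have A: "A \<in> sets P" using sub by (auto simp: sets_history)
    \<comment> \<open>The whole space is itself a generating event, so the total integral vanishes;
      this is what handles complements.\<close>
    have "space P \<inter> {w \<in> space P. \<forall>j\<in>{1..<i}. G k j w \<in> (\<lambda>_. UNIV) j} \<in> history_events k i"
      using F_sub[of k] sets.top[of "F k"] by (intro history_eventsI) (auto simp: subalgebra_def)
    then have "space P \<in> history_events k i" by simp
    from event[OF this] have "(\<integral>w\<in>A \<union> (space P - A). (noise k i w \<bullet> b) \<partial>P) = 0"
      using sets.sets_into_space[OF A] by (simp add: Un_absorb1)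
    then show ?case
      using compl A by (subst (asm) set_integral_Un) (auto intro: sint)
  next
    case (union A)
    then have A: "A j \<in> sets P" for j using sub by (auto simp: sets_history)
    show ?case
      using union A by (subst lebesgue_integral_countable_add) (auto simp: disjoint_family_on_def intro: sint)
  qed
qed

lemma cond_exp_history_noise_eq_0:
  assumes i: "i \<in> {1..B}" and b: "b \<in> Basis"
  shows "AE w in P. real_cond_exp P (history k i) (\<lambda>w. noise k i w \<bullet> b) w = 0"
proof -
  interpret H: finite_measure_subalgebra P "history k i"
    using subalgebra_history[OF i] by unfold_locales
  show ?thesis
    using set_integral_history_event_noise_eq_0[OF i b] integrable_noise[OF i]
    by (intro H.real_cond_exp_charact) (auto simp: set_lebesgue_integral_def)
qed

text \<open>The martingale difference property, tested against an unbounded vector weight. It is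
  proved coordinatewise, with integrability of the product of the norms covering every coordinate
  product.\<close>

lemma integral_inner_noise_eq_0:
  assumes i: "i \<in> {1..B}" and \<psi>: "\<psi> \<in> borel_measurable (history k i)"
    and int: "integrable P (\<lambda>w. norm (\<psi> w) * norm (noise k i w))"
  shows "integrable P (\<lambda>w. \<psi> w \<bullet> noise k i w)" "(\<integral>w. \<psi> w \<bullet> noise k i w \<partial>P) = 0"
proof -
  interpret H: finite_measure_subalgebra P "history k i"
    using subalgebra_history[OF i] by unfold_locales
  have [measurable]: "\<psi> \<in> borel_measurable P" "noise k i \<in> borel_measurable P"
    using measurable_from_subalg[OF subalgebra_history[OF i] \<psi>] noise_measurable_P[OF i] by auto
  have intb: "integrable P (\<lambda>w. (\<psi> w \<bullet> b) * (noise k i w \<bullet> b))" if "b \<in> Basis" for b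
    by (rule Bochner_Integration.integrable_bound[OF int])
      (use that in \<open>auto simp: abs_mult intro!: mult_mono Basis_le_norm\<close>)
  have eq: "(\<lambda>w. \<psi> w \<bullet> noise k i w) = (\<lambda>w. \<Sum>b\<in>Basis. (\<psi> w \<bullet> b) * (noise k i w \<bullet> b))"
    by (simp add: euclidean_inner[symmetric])
  show "integrable P (\<lambda>w. \<psi> w \<bullet> noise k i w)"
    unfolding eq using intb by auto
  have "(\<integral>w. (\<psi> w \<bullet> b) * (noise k i w \<bullet> b) \<partial>P) = 0" if b: "b \<in> Basis" for b
  proof -
    have "(\<integral>w. (\<psi> w \<bullet> b) * (noise k i w \<bullet> b) \<partial>P)
        = (\<integral>w. (\<psi> w \<bullet> b) * real_cond_exp P (history k i) (\<lambda>w. noise k i w \<bullet> b) w \<partial>P)"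
      using intb[OF b] \<psi> by (subst H.real_cond_exp_intg(2)) auto
    also have "\<dots> = (\<integral>w. 0 \<partial>P)"
      using cond_exp_history_noise_eq_0[OF i b, of k] by (intro integral_cong_AE) auto
    finally show ?thesis by simp
  qed
  then show "(\<integral>w. \<psi> w \<bullet> noise k i w \<partial>P) = 0"
    unfolding eq using intb by (subst Bochner_Integration.integral_sum) auto
qed

section \<open>Moment estimate and potential for one batch\<close>

lemma integrable_powr_add:
  fixes S T :: "'w \<Rightarrow> 'a"
  assumes "S \<in> borel_measurable P" "T \<in> borel_measurable P"
    "integrable P (\<lambda>w. norm (S w) powr \<alpha>)" "integrable P (\<lambda>w. norm (T w) powr \<alpha>)"
  shows "integrable P (\<lambda>w. norm (S w + T w) powr \<alpha>)"
proof (rule Bochner_Integration.integrable_bound)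
  show "integrable P (\<lambda>w. 2 powr \<alpha> * (norm (S w) powr \<alpha> + norm (T w) powr \<alpha>))"
    using assms by simp
  show "(\<lambda>w. norm (S w + T w) powr \<alpha>) \<in> borel_measurable P"
    using assms(1,2) by measurable
  have "norm (S w + T w) powr \<alpha> \<le> 2 powr \<alpha> * (norm (S w) powr \<alpha> + norm (T w) powr \<alpha>)" for w
    using add_powr_le[of "norm (S w)" "norm (T w)" \<alpha>] \<alpha>
      powr_mono2[OF _ _ norm_triangle_ineq, of \<alpha> "S w" "T w"] by fastforce
  then show "AE w in P. norm (norm (S w + T w) powr \<alpha>)
      \<le> norm (2 powr \<alpha> * (norm (S w) powr \<alpha> + norm (T w) powr \<alpha>))"
    by simp
qed

text \<open>Samples are added one at a time by \<open>norm_powr_add_le\<close>; the linear term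
  integrates to \<open>0\<close> and the remainder is paid by \<open>moment_bound\<close>. The
  weight \<open>W\<close> is carried along so that the tangent slope of the potential can be
  inserted later.\<close>

lemma integral_weighted_batch_le:
  fixes S :: "'w \<Rightarrow> 'a"
  assumes S: "S \<in> borel_measurable (F k)" "integrable P (\<lambda>w. norm (S w) powr \<alpha>)"
    and W: "W \<in> borel_measurable (F k)" "\<And>w. 0 \<le> W w" "\<And>w. W w \<le> C"
    and n: "n \<le> B"
  shows "integrable P (\<lambda>w. norm (S w + c *\<^sub>R (\<Sum>i\<in>{1..n}. noise k i w)) powr \<alpha>) \<and>
    (\<integral>w. W w * norm (S w + c *\<^sub>R (\<Sum>i\<in>{1..n}. noise k i w)) powr \<alpha> \<partial>P)
     \<le> (\<integral>w. W w * norm (S w) powr \<alpha> \<partial>P) + n * (3 powr \<alpha> * \<bar>c\<bar> powr \<alpha>) * (\<integral>w. W w * moment_bound k w \<partial>P)"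
  using n
proof (induction n)
  case 0
  then show ?case using S by simp
next
  case (Suc n)
  then have i: "Suc n \<in> {1..B}" by simp
  define T where "T w = S w + c *\<^sub>R (\<Sum>i\<in>{1..n}. noise k i w)" for w
  define y where "y = noise k (Suc n)"
  have Tint: "integrable P (\<lambda>w. norm (T w) powr \<alpha>)"
    and IH: "(\<integral>w. W w * norm (T w) powr \<alpha> \<partial>P)
      \<le> (\<integral>w. W w * norm (S w) powr \<alpha> \<partial>P) + n * (3 powr \<alpha> * \<bar>c\<bar> powr \<alpha>) * (\<integral>w. W w * moment_bound k w \<partial>P)"
    using Suc unfolding T_def by auto
  have step: "S w + c *\<^sub>R (\<Sum>i\<in>{1..Suc n}. noise k i w) = T w + c *\<^sub>R y w" for w
    by (simp add: T_def y_def scaleR_add_right)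
  have noiseH: "noise k j \<in> borel_measurable (history k (Suc n))" if "j \<in> {1..n}" for j
    unfolding noise_def using that
    by (intro borel_measurable_diff measurable_history_G measurable_history_F D_meas) auto
  have TH: "T \<in> borel_measurable (history k (Suc n))"
    unfolding T_def
    by (intro borel_measurable_add borel_measurable_scaleR borel_measurable_const borel_measurable_sum
        noiseH measurable_history_F S)
  have WH: "W \<in> borel_measurable (history k (Suc n))" by (intro measurable_history_F W)
  have [measurable]: "T \<in> borel_measurable P" "W \<in> borel_measurable P" "y \<in> borel_measurable P"
    using measurable_from_subalg[OF subalgebra_history[OF i]] TH WH noise_measurable_P[OF i]
    by (auto simp: y_def)
  have yint: "integrable P (\<lambda>w. norm (y w) powr \<alpha>)" unfolding y_def by (rule integrable_noise_powr[OF i])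
  have cyint: "integrable P (\<lambda>w. norm (c *\<^sub>R y w) powr \<alpha>)"
    using yint by (simp add: powr_mult)
  have C0: "0 \<le> C" using W(2,3) order_trans by blast
  have Wint: "integrable P (\<lambda>w. W w * g w)" if "integrable P g" for g :: "'w \<Rightarrow> real"
  proof (rule Bochner_Integration.integrable_bound[OF integrable_mult_right[OF that, of C]])
    show "(\<lambda>w. W w * g w) \<in> borel_measurable P" using that by measurable
    show "AE w in P. norm (W w * g w) \<le> norm (C * g w)"
      using W(2,3) C0 by (auto simp: abs_mult intro!: mult_right_mono)
  qed
  \<comment> \<open>The coefficient of \<open>y\<close> in the linear term of
    \<open>norm_powr_add_le\<close>, times the weight. It depends only on earlier samples and grows
    like the power \<open>\<alpha> - 1\<close> of \<open>norm (T w)\<close>, so its product with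
    \<open>y\<close> is integrable.\<close>
  define \<psi> where "\<psi> w = (W w * (\<alpha> * c * norm (T w) powr (\<alpha> - 2))) *\<^sub>R T w" for w
  have \<psi>H: "\<psi> \<in> borel_measurable (history k (Suc n))"
    unfolding \<psi>_def using TH WH by measurable
  have [measurable]: "\<psi> \<in> borel_measurable P"
    unfolding \<psi>_def by measurable
  have norm_\<psi>: "norm (\<psi> w) = \<alpha> * \<bar>c\<bar> * (W w * norm (T w) powr (\<alpha> - 1))" for w
  proof (cases "T w = 0")
    case False
    then have "norm (T w) powr (\<alpha> - 2) * norm (T w) = norm (T w) powr (\<alpha> - 1)"
      by (simp add: powr_diff power2_eq_square)
    then show ?thesis using W(2)[of w] \<alpha> by (simp add: \<psi>_def abs_mult mult_ac)
  qed (simp add: \<psi>_def)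
  have "integrable P (\<lambda>w. norm (\<psi> w) * norm (y w))"
  proof (rule Bochner_Integration.integrable_bound)
    show "integrable P (\<lambda>w. \<alpha> * \<bar>c\<bar> * (W w * (norm (T w) powr \<alpha> + norm (y w) powr \<alpha>)))"
      by (intro integrable_mult_right Wint Bochner_Integration.integrable_add Tint yint)
    have "norm (\<psi> w) * norm (y w) \<le> \<alpha> * \<bar>c\<bar> * (W w * (norm (T w) powr \<alpha> + norm (y w) powr \<alpha>))" for w
      unfolding norm_\<psi> mult.assoc
      using W(2)[of w] \<alpha> by (intro mult_left_mono mult_powr_le_powr_add) auto
    then show "AE w in P. norm (norm (\<psi> w) * norm (y w))
       \<le> norm (\<alpha> * \<bar>c\<bar> * (W w * (norm (T w) powr \<alpha> + norm (y w) powr \<alpha>)))"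
      by (auto intro!: order_trans[OF _ abs_ge_self])
  qed measurable
  then have \<psi>y: "integrable P (\<lambda>w. \<psi> w \<bullet> y w)" "(\<integral>w. \<psi> w \<bullet> y w \<partial>P) = 0"
    using integral_inner_noise_eq_0[OF i \<psi>H] unfolding y_def by auto
  have Tyint: "integrable P (\<lambda>w. norm (T w + c *\<^sub>R y w) powr \<alpha>)"
    by (intro integrable_powr_add Tint cyint) auto
  have pointwise: "W w * norm (T w + c *\<^sub>R y w) powr \<alpha>
     \<le> W w * norm (T w) powr \<alpha> + \<psi> w \<bullet> y w + 3 powr \<alpha> * \<bar>c\<bar> powr \<alpha> * (W w * norm (y w) powr \<alpha>)" for w
    using mult_left_mono[OF norm_powr_add_le[OF \<alpha>, of "T w" "c *\<^sub>R y w"] W(2)[of w]]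
    by (simp add: \<psi>_def powr_mult algebra_simps)
  have "(\<integral>w. W w * norm (T w + c *\<^sub>R y w) powr \<alpha> \<partial>P)
     \<le> (\<integral>w. W w * norm (T w) powr \<alpha> + \<psi> w \<bullet> y w + 3 powr \<alpha> * \<bar>c\<bar> powr \<alpha> * (W w * norm (y w) powr \<alpha>) \<partial>P)"
    by (intro integral_mono pointwise Wint Tyint Bochner_Integration.integrable_add Tint \<psi>y
        integrable_mult_right yint)
  also have "\<dots> = (\<integral>w. W w * norm (T w) powr \<alpha> \<partial>P) + 0
       + 3 powr \<alpha> * \<bar>c\<bar> powr \<alpha> * (\<integral>w. W w * norm (y w) powr \<alpha> \<partial>P)"
    using Wint[OF Tint] Wint[OF yint] \<psi>y by simp
  also have "(\<integral>w. W w * norm (y w) powr \<alpha> \<partial>P) \<le> (\<integral>w. W w * moment_bound k w \<partial>P)"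
    unfolding y_def using integral_noise_powr_le[OF i W] .
  finally have "(\<integral>w. W w * norm (T w + c *\<^sub>R y w) powr \<alpha> \<partial>P)
     \<le> (\<integral>w. W w * norm (T w) powr \<alpha> \<partial>P) + 3 powr \<alpha> * \<bar>c\<bar> powr \<alpha> * (\<integral>w. W w * moment_bound k w \<partial>P)"
    by (simp add: mult_left_mono)
  then show ?case
    using IH Tyint unfolding step by (simp add: algebra_simps)
qed

text \<open>
  Instead of a conditional Jensen inequality, \<open>t\<^bsup>1/\<alpha>\<^esup>\<close> is bounded by its tangent at \<open>U\<close>; the slope
  \<open>W\<close> is bounded (as \<open>A > 0\<close>) and measurable with respect to \<open>F k\<close>.
\<close>

lemma potential_step:
  fixes S :: "'w \<Rightarrow> 'a"
  assumes S: "S \<in> borel_measurable (F k)" "integrable P (\<lambda>w. norm (S w) powr \<alpha>)"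
    and A: "A > 0"
  shows "(\<integral>w. (A + norm (S w + c *\<^sub>R (\<Sum>i\<in>{1..B}. noise k i w)) powr \<alpha>) powr (1/\<alpha>) \<partial>P)
    \<le> (\<integral>w. (A + B * (3 * \<bar>c\<bar> * \<sigma>0) powr \<alpha> + norm (S w) powr \<alpha>) powr (1/\<alpha>) \<partial>P)
      + 3 * \<bar>c\<bar> * B powr (1/\<alpha>) * \<sigma>1 * (\<integral>w. norm (D k w) \<partial>P)"
proof -
  define p where "p = 1/\<alpha>"
  have p: "0 < p" "p \<le> 1" and \<alpha>p: "\<alpha> * p = 1" using \<alpha> by (auto simp: p_def)
  define \<kappa> where "\<kappa> = B * (3 powr \<alpha> * \<bar>c\<bar> powr \<alpha>)"
  have \<kappa>: "\<kappa> \<ge> 0" by (simp add: \<kappa>_def)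
  define T where "T w = S w + c *\<^sub>R (\<Sum>i\<in>{1..B}. noise k i w)" for w
  \<comment> \<open>The point of tangency contains the full conditional moment budget of the batch.
    With this choice the first-order term has nonpositive integral, by \<open>WT\<close>.\<close>
  define U where "U w = A + norm (S w) powr \<alpha> + \<kappa> * moment_bound k w" for w
  define W where "W w = p * U w powr (p - 1)" for w
  have U: "A \<le> U w" for w using \<kappa> moment_bound_nonneg by (simp add: U_def)
  have UF: "U \<in> borel_measurable (F k)" unfolding U_def using S(1) by measurable
  have WF: "W \<in> borel_measurable (F k)" unfolding W_def using UF by measurable
  have W0: "0 \<le> W w" for w using p by (simp add: W_def)
  have WC: "W w \<le> p * A powr (p - 1)" for w
    unfolding W_def using p A U by (intro mult_left_mono powr_mono2') auto
  have [measurable]: "S \<in> borel_measurable P" "U \<in> borel_measurable P" "W \<in> borel_measurable P"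
    using measurable_from_subalg[OF F_sub] S(1) UF WF by blast+
  have Tm[measurable]: "T \<in> borel_measurable P"
    unfolding T_def by (intro borel_measurable_add borel_measurable_scaleR borel_measurable_sum) auto
  have Tint: "integrable P (\<lambda>w. norm (T w) powr \<alpha>)"
    and WT: "(\<integral>w. W w * norm (T w) powr \<alpha> \<partial>P)
      \<le> (\<integral>w. W w * norm (S w) powr \<alpha> \<partial>P) + \<kappa> * (\<integral>w. W w * moment_bound k w \<partial>P)"
    using integral_weighted_batch_le[OF S WF W0 WC order_refl, of c] unfolding T_def \<kappa>_def by auto
  obtain C where C: "moment_bound k w \<le> C" for w using moment_bound_bounded by blast
  have mint: "integrable P (moment_bound k)"
    using C moment_bound_nonneg by (intro integrable_bounded[of _ C]) auto
  have Uint: "integrable P U" unfolding U_def using S(2) mint by simp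
  have Wint: "integrable P (\<lambda>w. W w * g w)" if "integrable P g" for g :: "'w \<Rightarrow> real"
  proof (rule Bochner_Integration.integrable_bound[OF integrable_mult_right[OF that, of "p * A powr (p - 1)"]])
    show "(\<lambda>w. W w * g w) \<in> borel_measurable P" using that by measurable
    show "AE w in P. norm (W w * g w) \<le> norm (p * A powr (p - 1) * g w)"
      using W0 WC p by (auto simp: abs_mult intro!: mult_right_mono)
  qed
  have root_int: "integrable P (\<lambda>w. g w powr p)" if "integrable P g" "\<And>w. 0 \<le> g w" for g :: "'w \<Rightarrow> real"
  proof (rule Bochner_Integration.integrable_bound)
    show "integrable P (\<lambda>w. 1 + g w)" using that by simp
    show "(\<lambda>w. g w powr p) \<in> borel_measurable P" using that by measurable
    have "g w powr p \<le> 1 + g w" for w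
    proof -
      have "g w powr p \<le> 1 + p * (g w - 1)"
        using powr_le_tangent[OF that(2), of 1 p w] p by simp
      also have "\<dots> \<le> 1 + g w"
        using mult_left_le_one_le[of "g w" p] that(2)[of w] p by (simp add: algebra_simps)
      finally show ?thesis .
    qed
    then show "AE w in P. norm (g w powr p) \<le> norm (1 + g w)" using that(2) by simp
  qed
  have "(\<integral>w. (A + norm (T w) powr \<alpha>) powr p \<partial>P)
      \<le> (\<integral>w. U w powr p + (W w * norm (T w) powr \<alpha> - W w * (U w - A)) \<partial>P)"
  proof (intro integral_mono)
    fix w
    show "(A + norm (T w) powr \<alpha>) powr p \<le> U w powr p + (W w * norm (T w) powr \<alpha> - W w * (U w - A))"
      using powr_le_tangent[of "A + norm (T w) powr \<alpha>" "U w" p] A U[of w] p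
      by (simp add: W_def algebra_simps)
  qed (use A U Uint Tint in \<open>auto intro!: root_int Wint Bochner_Integration.integrable_add
      Bochner_Integration.integrable_diff intro: order_trans[OF less_imp_le]\<close>)
  also have "\<dots> = (\<integral>w. U w powr p \<partial>P) + ((\<integral>w. W w * norm (T w) powr \<alpha> \<partial>P) - (\<integral>w. W w * (U w - A) \<partial>P))"
  proof -
    have "integrable P (\<lambda>w. U w powr p)"
      using Uint U A by (intro root_int) (auto intro: order_trans[OF less_imp_le])
    moreover have "integrable P (\<lambda>w. W w * (U w - A))"
      using Uint by (intro Wint) simp
    ultimately show ?thesis using Wint[OF Tint] by simp
  qed
  also have "(\<integral>w. W w * (U w - A) \<partial>P)
      = (\<integral>w. W w * norm (S w) powr \<alpha> \<partial>P) + \<kappa> * (\<integral>w. W w * moment_bound k w \<partial>P)"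
  proof -
    have "(\<integral>w. W w * (U w - A) \<partial>P) = (\<integral>w. W w * norm (S w) powr \<alpha> + \<kappa> * (W w * moment_bound k w) \<partial>P)"
      by (simp add: U_def algebra_simps)
    then show ?thesis using Wint[OF S(2)] Wint[OF mint] by simp
  qed
  finally have "(\<integral>w. (A + norm (T w) powr \<alpha>) powr p \<partial>P) \<le> (\<integral>w. U w powr p \<partial>P)"
    using WT by linarith
  also have "\<dots> \<le> (\<integral>w. (A + B * (3 * \<bar>c\<bar> * \<sigma>0) powr \<alpha> + norm (S w) powr \<alpha>) powr p
      + 3 * \<bar>c\<bar> * B powr p * \<sigma>1 * norm (D k w) \<partial>P)"
  proof (rule integral_mono)
    show "integrable P (\<lambda>w. U w powr p)" using Uint U A by (intro root_int) (auto intro: order_trans[OF less_imp_le])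
    show "integrable P (\<lambda>w. (A + B * (3 * \<bar>c\<bar> * \<sigma>0) powr \<alpha> + norm (S w) powr \<alpha>) powr p
      + 3 * \<bar>c\<bar> * B powr p * \<sigma>1 * norm (D k w))"
      using A S(2) integrable_D by (intro Bochner_Integration.integrable_add root_int integrable_mult_right integrable_norm) auto
    fix w
    \<comment> \<open>The deterministic \<open>\<sigma>0\<close> part stays inside the root, while
      subadditivity of the root splits off the random \<open>\<sigma>1\<close> part, where the
      powers \<open>\<alpha>\<close> and \<open>p\<close> cancel.\<close>
    have "U w = (A + B * (3 * \<bar>c\<bar> * \<sigma>0) powr \<alpha> + norm (S w) powr \<alpha>) + B * (3 * \<bar>c\<bar> * \<sigma>1 * norm (D k w)) powr \<alpha>"
      using \<sigma> by (simp add: U_def \<kappa>_def moment_bound_def powr_mult algebra_simps)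
    also have "\<dots> powr p \<le> (A + B * (3 * \<bar>c\<bar> * \<sigma>0) powr \<alpha> + norm (S w) powr \<alpha>) powr p
        + (B * (3 * \<bar>c\<bar> * \<sigma>1 * norm (D k w)) powr \<alpha>) powr p"
      using A p by (intro powr_add_le_add_powr) auto
    also have "(B * (3 * \<bar>c\<bar> * \<sigma>1 * norm (D k w)) powr \<alpha>) powr p = B powr p * (3 * \<bar>c\<bar> * \<sigma>1 * norm (D k w))"
      using \<sigma> \<alpha>p by (simp add: powr_mult powr_powr)
    finally show "U w powr p \<le> (A + B * (3 * \<bar>c\<bar> * \<sigma>0) powr \<alpha> + norm (S w) powr \<alpha>) powr p
      + 3 * \<bar>c\<bar> * B powr p * \<sigma>1 * norm (D k w)" by (simp add: mult_ac)
  qed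
  also have "\<dots> = (\<integral>w. (A + B * (3 * \<bar>c\<bar> * \<sigma>0) powr \<alpha> + norm (S w) powr \<alpha>) powr p \<partial>P)
      + 3 * \<bar>c\<bar> * B powr p * \<sigma>1 * (\<integral>w. norm (D k w) \<partial>P)"
    using A S(2) integrable_D by (subst Bochner_Integration.integral_add)
      (auto intro!: root_int)
  finally show ?thesis unfolding T_def p_def .
qed

section \<open>Noise accumulated over several batches\<close>

lemma F_mono_le: "j \<le> k \<Longrightarrow> sets (F j) \<subseteq> sets (F k)"
  using F_mono by (rule lift_Suc_mono_le)

lemma measurable_F_mono:
  assumes "f \<in> measurable (F j) N" "j \<le> k"
  shows "f \<in> measurable (F k) N"
  by (rule measurable_from_subalg[OF _ assms(1)])
    (use F_mono_le[OF assms(2)] F_sub in \<open>auto simp: subalgebra_def\<close>)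

lemma noise_measurable_F:
  assumes "i \<in> {1..B}" "j < k"
  shows "noise j i \<in> borel_measurable (F k)"
  unfolding noise_def
  by (intro borel_measurable_diff measurable_F_mono[OF G_meas[OF assms(1)]] measurable_F_mono[OF D_meas])
    (use assms in auto)

definition weighted_noise :: "(nat \<Rightarrow> real) \<Rightarrow> nat \<Rightarrow> 'w \<Rightarrow> 'a" where
  "weighted_noise c n w = (\<Sum>j<n. c j *\<^sub>R (\<Sum>i\<in>{1..B}. noise j i w))"

lemma weighted_noise_measurable: "weighted_noise c n \<in> borel_measurable (F n)"
  unfolding weighted_noise_def
  by (intro borel_measurable_sum borel_measurable_scaleR borel_measurable_const noise_measurable_F) auto

lemma integrable_weighted_noise_powr: "integrable P (\<lambda>w. norm (weighted_noise c n w) powr \<alpha>)"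
proof (induction n)
  case 0
  show ?case by (simp add: weighted_noise_def)
next
  case (Suc n)
  have *: "weighted_noise c (Suc n) w = weighted_noise c n w + c n *\<^sub>R (\<Sum>i\<in>{1..B}. noise n i w)" for w
    by (simp add: weighted_noise_def)
  show ?case
    unfolding *
    using integral_weighted_batch_le[OF weighted_noise_measurable Suc, of "\<lambda>_. 1" 1 B] by simp
qed

text \<open>The last batch is peeled off first and its \<open>\<sigma>0\<close> part is added to
  \<open>A\<close>; hence the induction has to keep \<open>A\<close> arbitrary.\<close>

lemma potential_weighted_noise_le:
  assumes "A > 0"
  shows "(\<integral>w. (A + norm (weighted_noise c n w) powr \<alpha>) powr (1/\<alpha>) \<partial>P)
    \<le> (A + B * (\<Sum>j<n. (3 * \<bar>c j\<bar> * \<sigma>0) powr \<alpha>)) powr (1/\<alpha>)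
      + 3 * B powr (1/\<alpha>) * \<sigma>1 * (\<Sum>j<n. \<bar>c j\<bar> * (\<integral>w. norm (D j w) \<partial>P))"
  using assms
proof (induction n arbitrary: A)
  case 0
  then show ?case using \<alpha> by (simp add: weighted_noise_def prob_space)
next
  case (Suc n)
  let ?A = "A + B * (3 * \<bar>c n\<bar> * \<sigma>0) powr \<alpha>"
  have A: "?A > 0" using Suc.prems by (intro add_pos_nonneg) auto
  have *: "weighted_noise c (Suc n) w = weighted_noise c n w + c n *\<^sub>R (\<Sum>i\<in>{1..B}. noise n i w)" for w
    by (simp add: weighted_noise_def)
  have "(\<integral>w. (A + norm (weighted_noise c (Suc n) w) powr \<alpha>) powr (1/\<alpha>) \<partial>P)
     \<le> (\<integral>w. (?A + norm (weighted_noise c n w) powr \<alpha>) powr (1/\<alpha>) \<partial>P)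
      + 3 * \<bar>c n\<bar> * B powr (1/\<alpha>) * \<sigma>1 * (\<integral>w. norm (D n w) \<partial>P)"
    unfolding * by (rule potential_step[OF weighted_noise_measurable integrable_weighted_noise_powr Suc.prems])
  also have "(\<integral>w. (?A + norm (weighted_noise c n w) powr \<alpha>) powr (1/\<alpha>) \<partial>P)
    \<le> (?A + B * (\<Sum>j<n. (3 * \<bar>c j\<bar> * \<sigma>0) powr \<alpha>)) powr (1/\<alpha>)
      + 3 * B powr (1/\<alpha>) * \<sigma>1 * (\<Sum>j<n. \<bar>c j\<bar> * (\<integral>w. norm (D j w) \<partial>P))"
    using Suc.IH[OF A] .
  finally show ?case by (simp add: algebra_simps)
qed

lemma weighted_noise_le_potential:
  assumes "A > 0"
  shows "norm (weighted_noise c n w) \<le> (A + norm (weighted_noise c n w) powr \<alpha>) powr (1/\<alpha>)"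
proof -
  have "norm (weighted_noise c n w) = (norm (weighted_noise c n w) powr \<alpha>) powr (1/\<alpha>)"
    using \<alpha> by (simp add: powr_powr)
  also have "\<dots> \<le> (A + norm (weighted_noise c n w) powr \<alpha>) powr (1/\<alpha>)"
    using assms \<alpha> by (intro powr_mono2) auto
  finally show ?thesis .
qed

lemma integrable_weighted_noise: "integrable P (weighted_noise c n)"
  unfolding weighted_noise_def
  by (intro Bochner_Integration.integrable_sum integrable_scaleR_right integrable_noise)

lemma expectation_norm_weighted_noise_le:
  "(\<integral>w. norm (weighted_noise c n w) \<partial>P)
    \<le> 3 * B powr (1/\<alpha>) * (\<sigma>0 * (\<Sum>j<n. \<bar>c j\<bar> powr \<alpha>) powr (1/\<alpha>)
         + \<sigma>1 * (\<Sum>j<n. \<bar>c j\<bar> * (\<integral>w. norm (D j w) \<partial>P)))"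
proof (rule field_le_epsilon)
  fix e :: real assume e: "e > 0"
  \<comment> \<open>The potential requires a positive offset. This one contributes exactly
    \<open>e\<close> after taking the root, and \<open>e\<close> is arbitrary.\<close>
  define A where "A = e powr \<alpha>"
  have A: "A > 0" using e by (simp add: A_def)
  have [measurable]: "weighted_noise c n \<in> borel_measurable P"
    using measurable_from_subalg[OF F_sub weighted_noise_measurable] .
  let ?V = "B * (\<Sum>j<n. (3 * \<bar>c j\<bar> * \<sigma>0) powr \<alpha>)"
  have potint: "integrable P (\<lambda>w. (A + norm (weighted_noise c n w) powr \<alpha>) powr (1/\<alpha>))"
  proof (rule Bochner_Integration.integrable_bound)
    show "integrable P (\<lambda>w. e + norm (weighted_noise c n w))"
      using integrable_weighted_noise by simp
    have "(A + norm (weighted_noise c n w) powr \<alpha>) powr (1/\<alpha>) \<le> e + norm (weighted_noise c n w)" for w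
      using powr_add_le_add_powr[of A "norm (weighted_noise c n w) powr \<alpha>" "1/\<alpha>"] A \<alpha> e
      by (simp add: powr_powr A_def)
    then show "AE w in P. norm ((A + norm (weighted_noise c n w) powr \<alpha>) powr (1/\<alpha>))
        \<le> norm (e + norm (weighted_noise c n w))"
      using e by simp
  qed measurable
  have "(\<integral>w. norm (weighted_noise c n w) \<partial>P)
      \<le> (\<integral>w. (A + norm (weighted_noise c n w) powr \<alpha>) powr (1/\<alpha>) \<partial>P)"
    using integrable_weighted_noise weighted_noise_le_potential[OF A] potint
    by (intro integral_mono) auto
  also have "\<dots> \<le> (A + ?V) powr (1/\<alpha>)
      + 3 * B powr (1/\<alpha>) * \<sigma>1 * (\<Sum>j<n. \<bar>c j\<bar> * (\<integral>w. norm (D j w) \<partial>P))"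
    by (rule potential_weighted_noise_le[OF A])
  also have "(A + ?V) powr (1/\<alpha>) \<le> A powr (1/\<alpha>) + ?V powr (1/\<alpha>)"
    using A \<alpha> by (intro powr_add_le_add_powr) (auto intro!: mult_nonneg_nonneg sum_nonneg)
  also have "A powr (1/\<alpha>) = e" using e \<alpha> by (simp add: A_def powr_powr)
  also have "?V powr (1/\<alpha>) = 3 * B powr (1/\<alpha>) * \<sigma>0 * (\<Sum>j<n. \<bar>c j\<bar> powr \<alpha>) powr (1/\<alpha>)"
  proof -
    have "(\<Sum>j<n. (3 * \<bar>c j\<bar> * \<sigma>0) powr \<alpha>) = (3 * \<sigma>0) powr \<alpha> * (\<Sum>j<n. \<bar>c j\<bar> powr \<alpha>)"
      using \<sigma> by (simp add: powr_mult sum_distrib_left mult_ac)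
    moreover have "((3 * \<sigma>0) powr \<alpha>) powr (1/\<alpha>) = 3 * \<sigma>0"
      using \<sigma> \<alpha> by (simp add: powr_powr)
    ultimately show ?thesis
      by (simp only:) (simp add: powr_mult sum_nonneg)
  qed
  finally show "(\<integral>w. norm (weighted_noise c n w) \<partial>P)
    \<le> 3 * B powr (1/\<alpha>) * (\<sigma>0 * (\<Sum>j<n. \<bar>c j\<bar> powr \<alpha>) powr (1/\<alpha>)
         + \<sigma>1 * (\<Sum>j<n. \<bar>c j\<bar> * (\<integral>w. norm (D j w) \<partial>P))) + e"
    by (simp add: algebra_simps)
qed

end

section \<open>Convergence of Muon\<close>

text \<open>A single random sign times a unit matrix has \<open>\<alpha>\<close>-th moment
  \<open>1\<close> on both sides of the inequality.\<close>

lemma vbe_constant_ge_1: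
  assumes vbe: "vbe_constant \<alpha> C TYPE('n::finite) TYPE('m::finite)"
  shows "1 \<le> C"
proof -
  define e :: "real^'n^'m" where "e = axis undefined (axis undefined 1)"
  have e: "norm e = 1" by (simp add: e_def norm_eq_sqrt_inner inner_axis_axis)
  \<comment> \<open>The measures in \<open>vbe_constant\<close> live on sequences of matrices, so
    the sign is encoded by a constant sequence, read off at index \<open>0\<close>.\<close>
  define g :: "bool \<Rightarrow> nat \<Rightarrow> real^'n^'m" where "g b = (\<lambda>_. if b then e else - e)" for b
  define Q where "Q = measure_pmf (map_pmf g (pmf_of_set UNIV))"
  define Y :: "nat \<Rightarrow> (nat \<Rightarrow> real^'n^'m) \<Rightarrow> real^'n^'m" where "Y i x = x 0" for i x
  interpret Q: prob_space Q unfolding Q_def by (rule prob_space_measure_pmf)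
  have int: "integrable Q (Y i)" for i
    unfolding Q_def by (intro integrable_measure_pmf_finite) auto
  have mean: "(\<integral>x. Y i x \<partial>Q) = 0" for i
    unfolding Q_def by (simp add: Y_def g_def integral_measure_pmf[of UNIV] UNIV_bool)
  have nn: "(\<integral>\<^sup>+x. ennreal (norm (Y i x) powr \<alpha>) \<partial>Q) = 1" for i
  proof -
    have "(\<integral>\<^sup>+x. ennreal (norm (Y i x) powr \<alpha>) \<partial>Q) = (\<integral>\<^sup>+b. 1 \<partial>measure_pmf (pmf_of_set (UNIV :: bool set)))"
      unfolding Q_def nn_integral_map_pmf
      by (intro nn_integral_cong) (auto simp: Y_def g_def e)
    then show ?thesis by simp
  qed
  have sub1: "J = {0}" if "J \<subseteq> {..<1::nat}" "J \<noteq> {}" for J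
    using that by auto
  have indep: "Q.indep_vars (\<lambda>_. borel) Y {..<1}"
    unfolding Q.indep_vars_def Q.indep_sets_def
  proof (intro conjI ballI allI impI)
    fix J A assume "J \<subseteq> {..<1::nat}" "J \<noteq> {}"
    then have "J = {0}" by (rule sub1)
    then show "Q.prob (\<Inter> (A ` J)) = (\<Prod>j\<in>J. Q.prob (A j))" by simp
  qed (auto simp: Q_def)
  have "(\<integral>\<^sup>+x. ennreal (norm (\<Sum>i<1. Y i x) powr \<alpha>) \<partial>Q)
          \<le> ennreal C * (\<Sum>i<1. \<integral>\<^sup>+x. ennreal (norm (Y i x) powr \<alpha>) \<partial>Q)"
    using vbe[unfolded vbe_constant_def, rule_format, of Q Y 1] Q.prob_space_axioms indep int mean nn
    by simp
  then have "1 \<le> ennreal C" by (simp add: nn)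
  then show ?thesis by (simp add: ennreal_ge_1)
qed

text \<open>Along the segment, the difference between \<open>f\<close> and its quadratic upper model
  is nonincreasing, because Cauchy--Schwarz and the Lipschitz bound make its derivative
  nonpositive.\<close>

lemma descent_lemma:
  fixes f :: "'a::real_inner \<Rightarrow> real"
  assumes grad: "\<And>Y. (f has_derivative (\<lambda>H. g Y \<bullet> H)) (at Y)"
    and smooth: "\<And>Y Z. norm (g Y - g Z) \<le> L * norm (Y - Z)"
  shows "f (Y + H) \<le> f Y + g Y \<bullet> H + L / 2 * (norm H)\<^sup>2"
proof -
  define \<phi> where "\<phi> t = f (Y + t *\<^sub>R H) - t * (g Y \<bullet> H) - L / 2 * t\<^sup>2 * (norm H)\<^sup>2" for t
  have deriv: "(\<phi> has_real_derivative ((g (Y + t *\<^sub>R H) - g Y) \<bullet> H - L * t * (norm H)\<^sup>2)) (at t)" for t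
  proof -
    have "((\<lambda>t. Y + t *\<^sub>R H) has_derivative (\<lambda>s. s *\<^sub>R H)) (at t)"
      by (auto intro!: derivative_eq_intros)
    from has_derivative_compose[OF this grad]
    have "((\<lambda>t. f (Y + t *\<^sub>R H)) has_real_derivative g (Y + t *\<^sub>R H) \<bullet> H) (at t)"
      unfolding has_field_derivative_def by (rule has_derivative_eq_rhs) (auto simp: fun_eq_iff)
    then show ?thesis
      unfolding \<phi>_def by (auto intro!: derivative_eq_intros simp: inner_diff_left algebra_simps)
  qed
  have "\<phi> 1 \<le> \<phi> 0"
  proof (rule DERIV_nonpos_imp_nonincreasing[where f = \<phi> and a = 0 and b = 1])
    fix t :: real assume t: "0 \<le> t" "t \<le> 1"
    have "(g (Y + t *\<^sub>R H) - g Y) \<bullet> H \<le> norm (g (Y + t *\<^sub>R H) - g Y) * norm H"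
      by (rule norm_cauchy_schwarz)
    also have "\<dots> \<le> L * norm (Y + t *\<^sub>R H - Y) * norm H"
      by (intro mult_right_mono smooth) auto
    also have "\<dots> = L * t * (norm H)\<^sup>2" using t by (simp add: power2_eq_square)
    finally show "\<exists>y. (\<phi> has_real_derivative y) (at t) \<and> y \<le> 0"
      using deriv[of t] by (intro exI conjI) auto
  qed simp
  then show ?thesis by (simp add: \<phi>_def)
qed

text \<open>
  \<open>(1 - \<beta>) * muon_weight \<beta> k j\<close> is the coefficient of the \<open>j\<close>-th batch noise in \<open>S k\<close> when the
  contribution of \<open>S 0\<close> is kept separate; it comes from
  \<open>S (k+1) = \<beta> S k + \<beta>\<^sup>2 (g k - g (k+1)) + (1 - \<beta>) ((1 + \<beta>) \<xi> (k+1) - \<beta> \<xi> k)\<close>.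
\<close>

primrec muon_weight :: "real \<Rightarrow> nat \<Rightarrow> nat \<Rightarrow> real" where
  "muon_weight \<beta> 0 j = 0"
| "muon_weight \<beta> (Suc k) j =
     \<beta> * muon_weight \<beta> k j + (if j = Suc k then 1 + \<beta> else 0) - (if j = k then \<beta> else 0)"

text \<open>A batch enters with \<open>1 + \<beta>\<close>, and one step later
  \<open>\<beta> * (1 + \<beta>) - \<beta>\<close> leaves the square of \<open>\<beta>\<close>.
  Batch \<open>0\<close> is exceptional: its entering part belongs to \<open>S 0\<close>, so only
  the negative correction remains.\<close>

lemma muon_weight_eq:
  "muon_weight \<beta> k j =
     (if k = 0 \<or> k < j then 0 else if j = k then 1 + \<beta> else if j = 0 then - (\<beta> ^ k) else \<beta> ^ (k - j + 1))"
proof (induction k)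
  case (Suc k)
  have "Suc k - j + 1 = Suc (k - j + 1)" if "j \<le> k" using that by simp
  then show ?case
    unfolding muon_weight.simps Suc
    by (auto simp: algebra_simps not_less power2_eq_square Suc_diff_le)
qed simp

lemma muon_error_decomposition:
  fixes Gb g :: "nat \<Rightarrow> real^'n^'m" and C :: "real^'n^'m" and \<beta> :: real
  defines "S \<equiv> \<lambda>k. (1 - \<beta>) *\<^sub>R muon_M \<beta> C Gb k - g k"
  shows "S k = \<beta> ^ k *\<^sub>R S 0 + \<beta>\<^sup>2 *\<^sub>R (\<Sum>j<k. \<beta> ^ (k - 1 - j) *\<^sub>R (g j - g (Suc j)))
     + (1 - \<beta>) *\<^sub>R (\<Sum>j<Suc k. muon_weight \<beta> k j *\<^sub>R (Gb j - g j))"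
proof (induction k)
  case 0
  show ?case by simp
next
  case (Suc k)
  let ?\<xi> = "\<lambda>j. Gb j - g j"
  define N where "N k = (\<Sum>j<Suc k. muon_weight \<beta> k j *\<^sub>R ?\<xi> j)" for k
  define R where "R k = (\<Sum>j<k. \<beta> ^ (k - 1 - j) *\<^sub>R (g j - g (Suc j)))" for k
  \<comment> \<open>Eliminating the buffer gives
    \<open>M (k+1) = \<beta> M k + (1 + \<beta>) G (k+1) - \<beta> G k\<close>; splitting each batch
    mean into gradient and noise yields the recursion.\<close>
  have rec: "S (Suc k) = \<beta> *\<^sub>R S k + \<beta>\<^sup>2 *\<^sub>R (g k - g (Suc k))
     + (1 - \<beta>) *\<^sub>R ((1 + \<beta>) *\<^sub>R ?\<xi> (Suc k) - \<beta> *\<^sub>R ?\<xi> k)"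
    unfolding S_def muon_M_def muon_C_def muon_Cprev.simps
    by (simp add: vec_eq_iff algebra_simps power2_eq_square)
  have R: "R (Suc k) = \<beta> *\<^sub>R R k + (g k - g (Suc k))"
  proof -
    have "\<beta> ^ (k - j) = \<beta> * \<beta> ^ (k - 1 - j)" if "j < k" for j
      using that by (simp flip: power_Suc add: Suc_diff_Suc)
    then have "(\<Sum>j<k. \<beta> ^ (k - j) *\<^sub>R (g j - g (Suc j))) = \<beta> *\<^sub>R R k"
      unfolding R_def scaleR_sum_right by (intro sum.cong) auto
    then show ?thesis by (simp add: R_def)
  qed
  have N: "N (Suc k) = \<beta> *\<^sub>R N k + ((1 + \<beta>) *\<^sub>R ?\<xi> (Suc k) - \<beta> *\<^sub>R ?\<xi> k)"
  proof -
    have "(\<Sum>j<k. muon_weight \<beta> (Suc k) j *\<^sub>R ?\<xi> j) = \<beta> *\<^sub>R (\<Sum>j<k. muon_weight \<beta> k j *\<^sub>R ?\<xi> j)"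
      unfolding scaleR_sum_right by (intro sum.cong) auto
    moreover have "muon_weight \<beta> k (Suc k) = 0" by (simp add: muon_weight_eq)
    ultimately show ?thesis
      by (simp add: N_def scaleR_add_right scaleR_diff_left)
  qed
  have "S (Suc k) = \<beta> *\<^sub>R (\<beta> ^ k *\<^sub>R S 0 + \<beta>\<^sup>2 *\<^sub>R R k + (1 - \<beta>) *\<^sub>R N k) + \<beta>\<^sup>2 *\<^sub>R (g k - g (Suc k))
     + (1 - \<beta>) *\<^sub>R ((1 + \<beta>) *\<^sub>R ?\<xi> (Suc k) - \<beta> *\<^sub>R ?\<xi> k)"
    unfolding rec using Suc by (simp add: N_def R_def)
  also have "\<dots> = \<beta> ^ Suc k *\<^sub>R S 0 + \<beta>\<^sup>2 *\<^sub>R R (Suc k) + (1 - \<beta>) *\<^sub>R N (Suc k)"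
    unfolding R N by (simp add: scaleR_add_right mult_ac)
  finally show ?case by (simp only: N_def R_def)
qed

text \<open>The diagonal is excluded. A step scales the old row by \<open>\<beta>\<close> and
  appends one entry; the bound persists since
  \<open>\<beta> * (2 - \<beta>) \<le> 1\<close>.\<close>

lemma sum_muon_weight_row_le:
  assumes "0 < \<beta>" "\<beta> < 1"
  shows "(\<Sum>j<k. \<bar>muon_weight \<beta> k j\<bar>) \<le> \<beta> / (1 - \<beta>)"
proof (induction k)
  case 0
  show ?case using assms by simp
next
  case (Suc k)
  have row: "(\<Sum>j<Suc k. \<bar>muon_weight \<beta> (Suc k) j\<bar>) = \<beta> * (\<Sum>j<k. \<bar>muon_weight \<beta> k j\<bar>) + \<bar>muon_weight \<beta> (Suc k) k\<bar>"
    using assms by (simp add: sum_distrib_left abs_mult)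
  show ?case
  proof (cases "k = 0")
    case True
    then show ?thesis using assms by (simp add: field_simps)
  next
    case False
    then have "\<bar>muon_weight \<beta> (Suc k) k\<bar> = \<beta>\<^sup>2"
      using assms by (simp add: muon_weight_eq power2_eq_square)
    then have "(\<Sum>j<Suc k. \<bar>muon_weight \<beta> (Suc k) j\<bar>) \<le> \<beta> * (\<beta> / (1 - \<beta>)) + \<beta>\<^sup>2"
      using row mult_left_mono[OF Suc, of \<beta>] assms by linarith
    also have "\<dots> = \<beta> / (1 - \<beta>) * (\<beta> * (2 - \<beta>))"
      using assms by (simp add: field_simps power2_eq_square)
    also have "\<dots> \<le> \<beta> / (1 - \<beta>) * 1"
    proof (rule mult_left_mono)
      have "0 \<le> (1 - \<beta>)\<^sup>2" by simp
      then show "\<beta> * (2 - \<beta>) \<le> 1" by (simp add: power2_eq_square algebra_simps)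
    qed (use assms in auto)
    finally show ?thesis by simp
  qed
qed

text \<open>Off-diagonal weights are at most \<open>1\<close>, so raising them to the power
  \<open>\<alpha>\<close> does not increase the row sum; the diagonal weight
  \<open>1 + \<beta> \<le> 2\<close> contributes \<open>2 powr \<alpha>\<close>. This produces the
  constant \<open>\<Gamma>\<close>.\<close>

lemma sum_muon_weight_powr_le:
  assumes "0 < \<beta>" "\<beta> < 1" "1 < \<alpha>"
  shows "(\<Sum>j<Suc k. \<bar>muon_weight \<beta> k j\<bar> powr \<alpha>) \<le> (2 powr \<alpha> + 1) / (1 - \<beta>)"
proof -
  have "\<bar>muon_weight \<beta> k j\<bar> powr \<alpha> \<le> \<bar>muon_weight \<beta> k j\<bar>" if "j < k" for j
  proof -
    have "\<bar>muon_weight \<beta> k j\<bar> \<le> 1"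
      using assms that by (auto simp: muon_weight_eq power_le_one mult_le_one)
    then show ?thesis using powr_mono'[of 1 \<alpha> "\<bar>muon_weight \<beta> k j\<bar>"] assms by simp
  qed
  then have "(\<Sum>j<k. \<bar>muon_weight \<beta> k j\<bar> powr \<alpha>) \<le> (\<Sum>j<k. \<bar>muon_weight \<beta> k j\<bar>)"
    by (intro sum_mono) auto
  also have "\<dots> \<le> \<beta> / (1 - \<beta>)" using assms by (intro sum_muon_weight_row_le)
  also have "\<dots> \<le> 1 / (1 - \<beta>)" using assms by (intro divide_right_mono) auto
  finally have "(\<Sum>j<k. \<bar>muon_weight \<beta> k j\<bar> powr \<alpha>) \<le> 1 / (1 - \<beta>)" .
  moreover have "\<bar>muon_weight \<beta> k k\<bar> powr \<alpha> \<le> 2 powr \<alpha>"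
    using assms by (intro powr_mono2) (auto simp: muon_weight_eq)
  moreover have "2 powr \<alpha> \<le> 2 powr \<alpha> / (1 - \<beta>)"
    using assms by (simp add: field_simps)
  ultimately show ?thesis by (simp add: add_divide_distrib)
qed

text \<open>The geometric sum telescopes after multiplication by \<open>1 - \<beta>\<close>. Thus
  each gradient norm is charged at most once over all error terms, which lets the
  \<open>\<sigma>1\<close> part be absorbed with coefficient \<open>1 - \<rho>\<close>.\<close>

lemma sum_muon_weight_column_le:
  assumes "0 < \<beta>" "\<beta> < 1"
  shows "(1 - \<beta>) * (\<Sum>k<K. \<bar>muon_weight \<beta> k j\<bar>) \<le> 1"
proof (cases "j = 0")
  case True
  have "(1 - \<beta>) * (\<Sum>k<K. \<bar>muon_weight \<beta> k 0\<bar>) \<le> (if K = 0 then 0 else \<beta> - \<beta> ^ K)"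
  proof (induction K)
    case (Suc K)
    then show ?case using assms by (auto simp: muon_weight_eq algebra_simps split: if_splits)
  qed simp
  also have "\<dots> \<le> 1" using assms by (auto intro: order_trans[of _ \<beta>])
  finally show ?thesis using True by simp
next
  case False
  have "(1 - \<beta>) * (\<Sum>k<K. \<bar>muon_weight \<beta> k j\<bar>) \<le> (if K \<le> j then 0 else 1 - \<beta> ^ (K - j + 1))"
  proof (induction K)
    case (Suc K)
    consider "K < j" | "K = j" | "j < K" by linarith
    then show ?case
    proof cases
      case 1
      then show ?thesis using Suc by (simp add: muon_weight_eq)
    next
      case 2
      then show ?thesis using Suc False assms
        by (simp add: muon_weight_eq algebra_simps power2_eq_square)
    next
      case 3
      then have "Suc K - j + 1 = Suc (K - j + 1)" by simp
      then show ?thesis using Suc False assms 3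
        by (simp add: muon_weight_eq algebra_simps abs_mult)
    qed
  qed simp
  also have "\<dots> \<le> 1" using assms by simp
  finally show ?thesis .
qed

text \<open>Replacing \<open>g Y\<close> by \<open>c *\<^sub>R M\<close> in the inner product with
  the polar factor costs \<open>sqrt d\<close> times the error; comparing their norms costs the
  error once more. This is the origin of \<open>1 + sqrt d\<close>.\<close>

lemma muon_step_descent:
  fixes f :: "real^'n::finite^'m::finite \<Rightarrow> real"
  assumes grad: "\<And>Y. (f has_derivative (\<lambda>H. g Y \<bullet> H)) (at Y)"
    and smooth: "\<And>Y Z. norm (g Y - g Z) \<le> L * norm (Y - Z)"
    and L: "0 \<le> L" and \<eta>: "0 < \<eta>" and c: "0 < c"
  defines "d \<equiv> real (min CARD('m) CARD('n))"
  shows "f (Y - \<eta> *\<^sub>R polar M) \<le> f Y - \<eta> * norm (g Y) + \<eta> * (1 + sqrt d) * norm (c *\<^sub>R M - g Y)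
     + L * d * \<eta>\<^sup>2 / 2"
proof -
  define Q where "Q = polar M"
  have Q: "norm Q \<le> sqrt d" "norm M \<le> M \<bullet> Q"
    unfolding Q_def d_def using polar_factor_norm[OF is_polar_factor_polar, of M] by auto
  have d: "0 \<le> d" by (simp add: d_def)
  have "(c *\<^sub>R M - g Y) \<bullet> Q \<le> norm (c *\<^sub>R M - g Y) * norm Q"
    by (rule norm_cauchy_schwarz)
  also have "\<dots> \<le> norm (c *\<^sub>R M - g Y) * sqrt d"
    using Q by (intro mult_left_mono) auto
  finally have "c * (M \<bullet> Q) - norm (c *\<^sub>R M - g Y) * sqrt d \<le> g Y \<bullet> Q"
    by (simp add: inner_diff_left)
  moreover have "norm (c *\<^sub>R M) \<le> c * (M \<bullet> Q)" using Q c by simp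
  moreover have "norm (g Y) \<le> norm (c *\<^sub>R M) + norm (c *\<^sub>R M - g Y)"
    by (metis norm_minus_commute norm_triangle_sub add.commute)
  ultimately have gQ: "norm (g Y) - (1 + sqrt d) * norm (c *\<^sub>R M - g Y) \<le> g Y \<bullet> Q"
    by (simp add: algebra_simps)
  have "(norm Q)\<^sup>2 \<le> d" using Q(1) d by (simp add: real_le_rsqrt sqrt_ge_absD)
  then have "L / 2 * (\<eta>\<^sup>2 * (norm Q)\<^sup>2) \<le> L / 2 * (\<eta>\<^sup>2 * d)"
    using L by (intro mult_left_mono) auto
  moreover have "f (Y + (- \<eta>) *\<^sub>R Q) \<le> f Y + g Y \<bullet> ((- \<eta>) *\<^sub>R Q) + L / 2 * (norm ((- \<eta>) *\<^sub>R Q))\<^sup>2"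
    by (rule descent_lemma[OF grad smooth])
  moreover have "\<eta> * (norm (g Y) - (1 + sqrt d) * norm (c *\<^sub>R M - g Y)) \<le> \<eta> * (g Y \<bullet> Q)"
    using gQ \<eta> by (intro mult_left_mono) auto
  ultimately show ?thesis
    by (simp add: Q_def[symmetric] power_mult_distrib algebra_simps)
qed

theorem mainTheorem14:
  fixes f :: "real^'n::finite^'m::finite \<Rightarrow> real"
    and gradf :: "real^'n^'m \<Rightarrow> real^'n^'m"
    and fstar L \<alpha> \<sigma>0 \<sigma>1 \<eta> \<beta> C\<alpha> \<rho> :: real
    and K B :: nat
    and X0 Cm1 :: "real^'n^'m"
    and P :: "'w measure"
    and F :: "nat \<Rightarrow> 'w measure"
    and G :: "nat \<Rightarrow> nat \<Rightarrow> 'w \<Rightarrow> real^'n^'m"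
    and X :: "nat \<Rightarrow> 'w \<Rightarrow> real^'n^'m"
  assumes grad: "\<And>Y. (f has_derivative (\<lambda>H. gradf Y \<bullet> H)) (at Y)"
    and lower: "\<And>Y. f Y \<ge> fstar"
    and smooth: "\<And>Y Z. norm (gradf Y - gradf Z) \<le> L * norm (Y - Z)"
    and C\<alpha>_pos: "0 < C\<alpha>" and C\<alpha>_le: "C\<alpha> \<le> 2"
    and C\<alpha>: "vbe_constant \<alpha> C\<alpha> TYPE('n) TYPE('m)"
    and \<alpha>: "1 < \<alpha>" "\<alpha> \<le> 2"
    and \<sigma>: "0 \<le> \<sigma>0" "0 \<le> \<sigma>1"
    and K: "1 \<le> K"
    and \<eta>: "0 < \<eta>"
    and \<beta>: "0 < \<beta>" "\<beta> < 1"
    and B: "real B > (2 * sqrt pi * (1 + sqrt (min CARD('m) CARD('n))) * C\<alpha> powr (1 / \<alpha>) * \<sigma>1)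
                      powr (\<alpha> / (\<alpha> - 1))"
    and \<rho>_def: "\<rho> = 1 - (1 + sqrt (min CARD('m) CARD('n))) * 2 * sqrt pi * C\<alpha> powr (1 / \<alpha>) * \<sigma>1
                       / real B powr ((\<alpha> - 1) / \<alpha>)"
    and P: "prob_space P"
    and F_sub: "\<And>k. subalgebra P (F k)"
    and F_mono: "\<And>k. sets (F k) \<subseteq> sets (F (Suc k))"
    and X_def: "X = (\<lambda>k w. muon_X \<eta> \<beta> X0 Cm1 (\<lambda>j. batch_mean G B j w) k)"
    and G_meas: "\<And>k i. i \<in> {1..B} \<Longrightarrow> G k i \<in> borel_measurable (F (Suc k))"
    and G_indep: "\<And>k (A :: nat \<Rightarrow> (real^'n^'m) set). (\<And>i. A i \<in> sets borel) \<Longrightarrow>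
         AE w in P. real_cond_exp P (F k) (\<lambda>w. \<Prod>i\<in>{1..B}. indicator (A i) (G k i w)) w
                   = (\<Prod>i\<in>{1..B}. real_cond_exp P (F k) (\<lambda>w. indicator (A i) (G k i w)) w)"
    and G_unbiased: "\<And>k i a b. i \<in> {1..B} \<Longrightarrow>
         AE w in P. real_cond_exp P (F k) (\<lambda>w. G k i w $ a $ b) w = gradf (X k w) $ a $ b"
    and G_moment: "\<And>k i. i \<in> {1..B} \<Longrightarrow>
         AE w in P. nn_cond_exp P (F k) (\<lambda>w. ennreal (norm (G k i w - gradf (X k w)) powr \<alpha>)) w
                   \<le> ennreal (\<sigma>0 powr \<alpha> + \<sigma>1 powr \<alpha> * norm (gradf (X k w)) powr \<alpha>)"
  shows "Min ((\<lambda>k. prob_space.expectation P (\<lambda>w. norm (gradf (X k w)))) ` {..<K})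
    \<le> (f X0 - fstar) / (\<eta> * \<rho> * real K)
      + L * real (min CARD('m) CARD('n)) * \<eta> / (2 * \<rho>)
      + (1 + sqrt (min CARD('m) CARD('n)))
          * prob_space.expectation P
              (\<lambda>w. norm ((1 - \<beta>) *\<^sub>R muon_M \<beta> Cm1 (\<lambda>j. batch_mean G B j w) 0 - gradf X0))
          / ((1 - \<beta>) * real K * \<rho>)
      + \<beta>\<^sup>2 / ((1 - \<beta>) * \<rho>) * L * \<eta> * sqrt (min CARD('m) CARD('n)) * (1 + sqrt (min CARD('m) CARD('n)))
      + (1 + sqrt (min CARD('m) CARD('n))) * (2 * sqrt pi * C\<alpha> powr (1 / \<alpha>))
          / (\<rho> * real B powr ((\<alpha> - 1) / \<alpha>))
          * (2 powr \<alpha> + 1) powr (1 / \<alpha>) * \<sigma>0 * (1 - \<beta>) powr ((\<alpha> - 1) / \<alpha>)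
      + (1 + sqrt (min CARD('m) CARD('n))) * (2 * sqrt pi * C\<alpha> powr (1 / \<alpha>) * \<sigma>1 * norm (gradf X0))
          / (\<rho> * real B powr ((\<alpha> - 1) / \<alpha>) * real K)"
proof -
  interpret prob_space P by (rule P)
  define d where "d = real (min CARD('m) CARD('n))"
  define s where "s = sqrt d"
  have s: "0 \<le> s" by (simp add: s_def d_def)
  \<comment> \<open>The sign follows from the Lipschitz bound at two distinct matrices; the descent
    and drift estimates multiply by \<open>L\<close>.\<close>
  have L: "0 \<le> L"
  proof -
    have "(1 :: real^'n^'m) \<noteq> 0" by (simp add: vec_eq_iff)
    then have "0 < norm (1 - 0 :: real^'n^'m)" by simp
    moreover have "0 \<le> L * norm (1 - 0 :: real^'n^'m)"
      using smooth[of 1 0] norm_ge_zero order_trans by blast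
    ultimately show ?thesis by (simp add: zero_le_mult_iff)
  qed
  have \<beta>1: "0 < 1 - \<beta>" using \<beta> by simp

  \<comment> \<open>Iterates and their gradients\<close>
  define Gb where "Gb w j = batch_mean G B j w" for w j
  define M where "M k w = muon_M \<beta> Cm1 (Gb w) k" for k w
  define D where "D k w = gradf (X k w)" for k w
  define S where "S k w = (1 - \<beta>) *\<^sub>R M k w - D k w" for k w
  have Gb_eq: "(\<lambda>j. batch_mean G B j w) = Gb w" for w by (simp add: Gb_def fun_eq_iff)
  have X_0: "X 0 w = X0" for w by (simp add: X_def)
  have X_Suc: "X (Suc k) w = X k w - \<eta> *\<^sub>R polar (M k w)" for k w
    by (simp add: X_def M_def Gb_eq)
  have polar_le: "norm (polar A) \<le> s" for A :: "real^'n^'m"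
    unfolding s_def d_def by (rule polar_factor_norm(1)[OF is_polar_factor_polar])
  have D_step: "norm (D k w - D (Suc k) w) \<le> L * \<eta> * s" for k w
  proof -
    have "norm (D k w - D (Suc k) w) \<le> L * norm (\<eta> *\<^sub>R polar (M k w))"
      using smooth[of "X k w" "X (Suc k) w"] by (simp add: D_def X_Suc)
    also have "\<dots> \<le> L * (\<eta> * s)"
      using polar_le \<eta> L by (simp add: mult_left_mono)
    finally show ?thesis by (simp add: mult.assoc)
  qed
  \<comment> \<open>Steps of bounded length give a bound that is uniform in \<open>w\<close> for
    each fixed \<open>k\<close>, as the noise estimates require.\<close>
  have D_bounded: "norm (D k w) \<le> norm (gradf X0) + k * (L * \<eta> * s)" for k w
  proof (induction k)
    case 0
    show ?case by (simp add: D_def X_0)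
  next
    case (Suc k)
    have "norm (D (Suc k) w) \<le> norm (D k w) + norm (D k w - D (Suc k) w)"
      by (metis norm_minus_commute norm_triangle_sub add.commute)
    with Suc D_step[of k w] show ?case by (simp add: algebra_simps)
  qed

  \<comment> \<open>Measurability of the iterates\<close>
  have F_Suc: "h \<in> borel_measurable (F (Suc k))" if "h \<in> borel_measurable (F k)" for h :: "'w \<Rightarrow> real^'n^'m" and k
    by (rule measurable_from_subalg[OF _ that]) (use F_mono F_sub in \<open>auto simp: subalgebra_def\<close>)
  have Gb_meas: "(\<lambda>w. Gb w k) \<in> borel_measurable (F (Suc k))" for k
    unfolding Gb_def batch_mean_def
    by (intro borel_measurable_scaleR borel_measurable_const borel_measurable_sum G_meas)
  \<comment> \<open>Index \<open>k\<close> stands for the buffer before batch \<open>k\<close> is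
    drawn, hence \<open>F k\<close> rather than \<open>F (Suc k)\<close>.\<close>
  have Cprev_meas: "(\<lambda>w. muon_Cprev \<beta> Cm1 (Gb w) k) \<in> borel_measurable (F k)" for k
  proof (induction k)
    case (Suc k)
    then show ?case using Gb_meas F_Suc[OF Suc]
      by (auto intro!: borel_measurable_add borel_measurable_scaleR)
  qed simp
  have M_meas: "M k \<in> borel_measurable (F (Suc k))" for k
    unfolding M_def muon_M_def muon_C_def
    by (intro borel_measurable_add borel_measurable_scaleR borel_measurable_const Gb_meas F_Suc[OF Cprev_meas])
  have X_meas: "X k \<in> borel_measurable (F k)" for k
  proof (induction k)
    case 0
    have "X 0 = (\<lambda>_. X0)" by (simp add: X_0 fun_eq_iff)
    then show ?case by simp
  next
    case (Suc k)
    have "X (Suc k) = (\<lambda>w. X k w - \<eta> *\<^sub>R polar (M k w))" by (simp add: X_Suc fun_eq_iff)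
    moreover have "(\<lambda>w. polar (M k w)) \<in> borel_measurable (F (Suc k))"
      using measurable_compose[OF M_meas borel_measurable_polar] .
    ultimately show ?case
      using F_Suc[OF Suc] by (auto intro!: borel_measurable_diff borel_measurable_scaleR)
  qed
  have "continuous_on UNIV gradf"
    using smooth L by (intro lipschitz_on_continuous_on[of L] lipschitz_onI) (auto simp: dist_norm)
  then have gradf_meas: "gradf \<in> borel_measurable borel" by (rule borel_measurable_continuous_onI)
  have D_meas: "D k \<in> borel_measurable (F k)" for k
    unfolding D_def using measurable_compose[OF X_meas gradf_meas] .

  \<comment> \<open>The sampling model and integrability\<close>
  interpret N: heavy_tailed_batches P F G D B \<alpha> \<sigma>0 \<sigma>1
  proof
    show "\<exists>c. \<forall>w. norm (D k w) \<le> c" for k using D_bounded by blast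
    show "AE w in P. real_cond_exp P (F k) (\<lambda>w. G k i w \<bullet> b) w = D k w \<bullet> b"
      if i: "i \<in> {1..B}" and b: "b \<in> Basis" for k i b
    proof -
      obtain a c where "b = axis a (axis c 1)" using b by (auto simp: Basis_vec_def)
      then have "x \<bullet> b = x $ a $ c" for x :: "real^'n^'m" by (simp add: inner_axis)
      then show ?thesis using G_unbiased[OF i, of k a c] by (simp add: D_def)
    qed
    show "AE w in P. real_cond_exp P (F k) (\<lambda>w. \<Prod>i\<in>{1..B}. indicator (A i) (G k i w)) w
                   = (\<Prod>i\<in>{1..B}. real_cond_exp P (F k) (\<lambda>w. indicator (A i) (G k i w)) w)"
      if "\<And>i. A i \<in> sets borel" for k and A :: "nat \<Rightarrow> (real^'n^'m) set"
      using G_indep[where A = A, OF that] .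
    show "AE w in P. nn_cond_exp P (F k) (\<lambda>w. ennreal (norm (G k i w - D k w) powr \<alpha>)) w
                   \<le> ennreal (\<sigma>0 powr \<alpha> + \<sigma>1 powr \<alpha> * norm (D k w) powr \<alpha>)"
      if "i \<in> {1..B}" for k i
      using G_moment[OF that, of k] by (simp add: D_def)
  qed (use \<alpha> \<sigma> F_sub F_mono D_meas G_meas in auto)

  have Gb_int: "integrable P (\<lambda>w. Gb w k)" for k
    unfolding Gb_def batch_mean_def
    by (intro integrable_scaleR_right Bochner_Integration.integrable_sum N.integrable_G)
  have Cprev_int: "integrable P (\<lambda>w. muon_Cprev \<beta> Cm1 (Gb w) k)" for k
    by (induction k) (auto intro!: Bochner_Integration.integrable_add integrable_scaleR_right Gb_int)
  have S_int: "integrable P (S k)" for k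
    unfolding S_def M_def muon_M_def muon_C_def
    by (intro Bochner_Integration.integrable_add Bochner_Integration.integrable_diff
        integrable_scaleR_right Gb_int Cprev_int N.integrable_D)

  define Eg where "Eg k = (\<integral>w. norm (D k w) \<partial>P)" for k
  define ES where "ES k = (\<integral>w. norm (S k w) \<partial>P)" for k
  have Eg0: "0 \<le> Eg k" for k by (simp add: Eg_def)
  have ES0: "0 \<le> ES k" for k by (simp add: ES_def)

  \<comment> \<open>Summed descent inequality\<close>
  have descent: "\<eta> * (\<Sum>k<K. Eg k) \<le> f X0 - fstar + \<eta> * (1 + s) * (\<Sum>k<K. ES k) + K * (L * d * \<eta>\<^sup>2 / 2)"
  proof -
    have step: "\<eta> * norm (D k w) \<le> f (X k w) - f (X (Suc k) w) + \<eta> * (1 + s) * norm (S k w) + L * d * \<eta>\<^sup>2 / 2" for k w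
      using muon_step_descent[OF grad smooth L \<eta> \<beta>1, of "X k w" "M k w"]
      by (simp add: D_def S_def X_Suc s_def d_def)
    \<comment> \<open>The values of \<open>f\<close> telescope pointwise and are bounded by
      constants before integrating, so only norms remain under the expectation.\<close>
    have "\<eta> * (\<Sum>k<K. norm (D k w)) \<le> f X0 - fstar + \<eta> * (1 + s) * (\<Sum>k<K. norm (S k w)) + K * (L * d * \<eta>\<^sup>2 / 2)" for w
    proof -
      have "\<eta> * (\<Sum>k<K. norm (D k w))
         \<le> (\<Sum>k<K. f (X k w) - f (X (Suc k) w) + \<eta> * (1 + s) * norm (S k w) + L * d * \<eta>\<^sup>2 / 2)"
        unfolding sum_distrib_left by (intro sum_mono step)
      also have "\<dots> = (f (X 0 w) - f (X K w)) + \<eta> * (1 + s) * (\<Sum>k<K. norm (S k w)) + K * (L * d * \<eta>\<^sup>2 / 2)"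
        using sum_lessThan_telescope'[of "\<lambda>k. f (X k w)" K]
        by (simp add: sum.distrib sum_distrib_left)
      finally show ?thesis using lower[of "X K w"] by (simp add: X_0)
    qed
    then have "(\<integral>w. \<eta> * (\<Sum>k<K. norm (D k w)) \<partial>P)
      \<le> (\<integral>w. f X0 - fstar + \<eta> * (1 + s) * (\<Sum>k<K. norm (S k w)) + K * (L * d * \<eta>\<^sup>2 / 2) \<partial>P)"
      using S_int N.integrable_D by (intro integral_mono) auto
    then show ?thesis
      using S_int N.integrable_D by (simp add: Eg_def ES_def prob_space)
  qed

  \<comment> \<open>Constants of the final bound\<close>
  define q where "q = (\<alpha> - 1) / \<alpha>"
  define \<Gamma> where "\<Gamma> = (2 powr \<alpha> + 1) powr (1 / \<alpha>)"
  define \<kappa> where "\<kappa> = 2 * sqrt pi * C\<alpha> powr (1 / \<alpha>) / real B powr q"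
  have q: "q = 1 - 1 / \<alpha>" using \<alpha> by (simp add: q_def field_simps)
  have B0: "0 < real B" using B by (rule le_less_trans[OF powr_ge_zero])
  have \<kappa>_ge: "3 * B powr (1/\<alpha>) / B \<le> \<kappa>"
  proof -
    have "sqrt (9/4) \<le> sqrt pi" using pi_gt3 by (intro real_sqrt_le_mono) linarith
    moreover have "sqrt (9/4) = 3/2" by (simp add: real_sqrt_divide)
    ultimately have "3/2 \<le> sqrt pi" by simp
    moreover have "1 \<le> C\<alpha> powr (1/\<alpha>)"
      using vbe_constant_ge_1[OF C\<alpha>] \<alpha> by (intro ge_one_powr_ge_zero) auto
    ultimately have "3/2 * 1 \<le> sqrt pi * C\<alpha> powr (1/\<alpha>)" by (intro mult_mono) auto
    then have "3 / real B powr q \<le> \<kappa>"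
      unfolding \<kappa>_def by (intro divide_right_mono) auto
    moreover have "real B powr (1/\<alpha>) / B = 1 / real B powr q"
      using B0 by (simp add: q powr_diff)
    ultimately show ?thesis by (metis times_divide_eq_right mult.right_neutral)
  qed
  have \<kappa>0: "0 \<le> \<kappa>" by (simp add: \<kappa>_def)

  \<comment> \<open>Momentum errors\<close>
  have ES_le: "ES k \<le> \<beta> ^ k * ES 0 + \<beta>\<^sup>2 * (L * \<eta> * s) / (1 - \<beta>)
      + \<kappa> * (\<sigma>0 * \<Gamma> * (1 - \<beta>) powr q + \<sigma>1 * (\<Sum>j<Suc k. (1 - \<beta>) * \<bar>muon_weight \<beta> k j\<bar> * Eg j))" for k
  proof -
    \<comment> \<open>The factor \<open>1 / B\<close> comes from the batch mean, since
      \<open>weighted_noise\<close> sums the individual samples.\<close>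
    define c where "c j = (1 - \<beta>) / B * muon_weight \<beta> k j" for j
    have noise: "(1 - \<beta>) *\<^sub>R (\<Sum>j<Suc k. muon_weight \<beta> k j *\<^sub>R (Gb w j - D j w)) = N.weighted_noise c (Suc k) w" for w
    proof -
      have "Gb w j - D j w = (1 / B) *\<^sub>R (\<Sum>i\<in>{1..B}. N.noise j i w)" for j
        using B0 by (simp add: Gb_def batch_mean_def N.noise_def sum_subtractf scaleR_diff_right
            sum_constant_scaleR del: sum_constant)
      then show ?thesis
        by (simp add: N.weighted_noise_def c_def scaleR_add_right scaleR_sum_right[of "1 - \<beta>"])
    qed
    have geom: "(\<Sum>j<k. \<beta> ^ (k - 1 - j)) \<le> 1 / (1 - \<beta>)"
    proof -
      have "(\<Sum>j<k. \<beta> ^ (k - 1 - j)) = (\<Sum>j<k. \<beta> ^ j)"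
        using sum.nat_diff_reindex[of "\<lambda>j. \<beta> ^ j" k] by simp
      also have "\<dots> = (1 - \<beta> ^ k) / (1 - \<beta>)" using \<beta> by (simp add: sum_gp_strict)
      also have "\<dots> \<le> 1 / (1 - \<beta>)" using \<beta> by (intro divide_right_mono) auto
      finally show ?thesis .
    qed
    have "norm (S k w) \<le> \<beta> ^ k * norm (S 0 w) + \<beta>\<^sup>2 * (L * \<eta> * s) / (1 - \<beta>) + norm (N.weighted_noise c (Suc k) w)" for w
    proof -
      define R where "R = (\<Sum>j<k. \<beta> ^ (k - 1 - j) *\<^sub>R (D j w - D (Suc j) w))"
      have "norm R \<le> (\<Sum>j<k. \<beta> ^ (k - 1 - j) * (L * \<eta> * s))"
        unfolding R_def
      proof (rule sum_norm_le)
        fix j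
        show "norm (\<beta> ^ (k - 1 - j) *\<^sub>R (D j w - D (Suc j) w)) \<le> \<beta> ^ (k - 1 - j) * (L * \<eta> * s)"
          using D_step[of j w] \<beta> by (simp add: mult_left_mono)
      qed
      also have "\<dots> \<le> 1 / (1 - \<beta>) * (L * \<eta> * s)"
        unfolding sum_distrib_right[symmetric] using geom L \<eta> s by (intro mult_right_mono) auto
      finally have "\<beta>\<^sup>2 * norm R \<le> \<beta>\<^sup>2 * (1 / (1 - \<beta>) * (L * \<eta> * s))"
        by (intro mult_left_mono) auto
      moreover have "S k w = \<beta> ^ k *\<^sub>R S 0 w + \<beta>\<^sup>2 *\<^sub>R R + N.weighted_noise c (Suc k) w"
        unfolding noise[symmetric] S_def M_def R_def
        by (rule muon_error_decomposition)
      then have "norm (S k w) \<le> norm (\<beta> ^ k *\<^sub>R S 0 w) + norm (\<beta>\<^sup>2 *\<^sub>R R) + norm (N.weighted_noise c (Suc k) w)"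
        using norm_triangle_le[OF add_right_mono[OF norm_triangle_ineq]] by metis
      ultimately show ?thesis using \<beta> by simp
    qed
    then have "ES k \<le> (\<integral>w. \<beta> ^ k * norm (S 0 w) + \<beta>\<^sup>2 * (L * \<eta> * s) / (1 - \<beta>) + norm (N.weighted_noise c (Suc k) w) \<partial>P)"
      unfolding ES_def using S_int N.integrable_weighted_noise by (intro integral_mono) auto
    also have "\<dots> = \<beta> ^ k * ES 0 + \<beta>\<^sup>2 * (L * \<eta> * s) / (1 - \<beta>) + (\<integral>w. norm (N.weighted_noise c (Suc k) w) \<partial>P)"
      using S_int N.integrable_weighted_noise by (simp add: ES_def prob_space)
    also have "(\<integral>w. norm (N.weighted_noise c (Suc k) w) \<partial>P)
       \<le> 3 * B powr (1/\<alpha>) * (\<sigma>0 * (\<Sum>j<Suc k. \<bar>c j\<bar> powr \<alpha>) powr (1/\<alpha>) + \<sigma>1 * (\<Sum>j<Suc k. \<bar>c j\<bar> * Eg j))"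
      unfolding Eg_def by (rule N.expectation_norm_weighted_noise_le)
    also have "(\<Sum>j<Suc k. \<bar>c j\<bar> * Eg j) = (\<Sum>j<Suc k. (1 - \<beta>) * \<bar>muon_weight \<beta> k j\<bar> * Eg j) / B"
      using \<beta>1 B0 unfolding sum_divide_distrib by (simp add: c_def abs_mult)
    \<comment> \<open>The common factor \<open>1 - \<beta>\<close> meets the root of the row bound
      \<open>1 / (1 - \<beta>)\<close>; this leaves the exponent
      \<open>q = 1 - 1/\<alpha>\<close>.\<close>
    also have "(\<Sum>j<Suc k. \<bar>c j\<bar> powr \<alpha>) powr (1/\<alpha>) \<le> \<Gamma> * (1 - \<beta>) powr q / B"
    proof -
      have "(\<Sum>j<Suc k. \<bar>c j\<bar> powr \<alpha>) = ((1 - \<beta>) / B) powr \<alpha> * (\<Sum>j<Suc k. \<bar>muon_weight \<beta> k j\<bar> powr \<alpha>)"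
        unfolding sum_distrib_left using \<beta>1 B0 by (intro sum.cong) (auto simp: c_def abs_mult powr_mult powr_divide)
      also have "\<dots> \<le> ((1 - \<beta>) / B) powr \<alpha> * ((2 powr \<alpha> + 1) / (1 - \<beta>))"
        using \<beta> \<alpha> by (intro mult_left_mono sum_muon_weight_powr_le) auto
      finally have "(\<Sum>j<Suc k. \<bar>c j\<bar> powr \<alpha>) powr (1/\<alpha>)
          \<le> (((1 - \<beta>) / B) powr \<alpha> * ((2 powr \<alpha> + 1) / (1 - \<beta>))) powr (1/\<alpha>)"
        using \<alpha> by (intro powr_mono2) (auto intro!: sum_nonneg add_nonneg_nonneg)
      also have "\<dots> = ((1 - \<beta>) / B) * (\<Gamma> / (1 - \<beta>) powr (1/\<alpha>))"
        using \<beta>1 B0 \<alpha> by (simp add: powr_mult powr_divide powr_powr \<Gamma>_def)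
      also have "\<dots> = \<Gamma> * (1 - \<beta>) powr q / B"
        using \<beta>1 by (simp add: q powr_diff mult.commute)
      finally show ?thesis .
    qed
    also have "3 * B powr (1/\<alpha>) * (\<sigma>0 * (\<Gamma> * (1 - \<beta>) powr q / B)
          + \<sigma>1 * ((\<Sum>j<Suc k. (1 - \<beta>) * \<bar>muon_weight \<beta> k j\<bar> * Eg j) / B))
       = 3 * B powr (1/\<alpha>) / B * (\<sigma>0 * \<Gamma> * (1 - \<beta>) powr q
          + \<sigma>1 * (\<Sum>j<Suc k. (1 - \<beta>) * \<bar>muon_weight \<beta> k j\<bar> * Eg j))"
      using B0 by (simp add: field_simps)
    also have "\<dots> \<le> \<kappa> * (\<sigma>0 * \<Gamma> * (1 - \<beta>) powr q
          + \<sigma>1 * (\<Sum>j<Suc k. (1 - \<beta>) * \<bar>muon_weight \<beta> k j\<bar> * Eg j))"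
      using \<kappa>_ge \<sigma> \<beta>1 Eg0
      by (intro mult_right_mono add_nonneg_nonneg mult_nonneg_nonneg sum_nonneg) (auto simp: \<Gamma>_def)
    finally show ?thesis using \<sigma> by (simp add: mult_left_mono)
  qed

  have ES_sum: "(\<Sum>k<K. ES k) \<le> ES 0 / (1 - \<beta>) + K * (\<beta>\<^sup>2 * (L * \<eta> * s) / (1 - \<beta>))
      + \<kappa> * (K * (\<sigma>0 * \<Gamma> * (1 - \<beta>) powr q) + \<sigma>1 * (\<Sum>k<K. Eg k))"
  proof -
    have "(\<Sum>k<K. ES k) \<le> (\<Sum>k<K. \<beta> ^ k * ES 0 + \<beta>\<^sup>2 * (L * \<eta> * s) / (1 - \<beta>)
      + \<kappa> * (\<sigma>0 * \<Gamma> * (1 - \<beta>) powr q + \<sigma>1 * (\<Sum>j<Suc k. (1 - \<beta>) * \<bar>muon_weight \<beta> k j\<bar> * Eg j)))"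
      by (intro sum_mono ES_le)
    also have "\<dots> = (\<Sum>k<K. \<beta> ^ k) * ES 0 + K * (\<beta>\<^sup>2 * (L * \<eta> * s) / (1 - \<beta>))
      + \<kappa> * (K * (\<sigma>0 * \<Gamma> * (1 - \<beta>) powr q)
          + \<sigma>1 * (\<Sum>k<K. \<Sum>j<Suc k. (1 - \<beta>) * \<bar>muon_weight \<beta> k j\<bar> * Eg j))"
      by (simp only: sum.distrib sum_distrib_left[symmetric] sum_distrib_right[symmetric] sum_constant card_lessThan)
        (simp only: mult_ac)
    also have "(\<Sum>k<K. \<beta> ^ k) * ES 0 \<le> 1 / (1 - \<beta>) * ES 0"
    proof (intro mult_right_mono ES0)
      have "(\<Sum>k<K. \<beta> ^ k) = (1 - \<beta> ^ K) / (1 - \<beta>)" using \<beta> by (simp add: sum_gp_strict)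
      also have "\<dots> \<le> 1 / (1 - \<beta>)" using \<beta> by (intro divide_right_mono) auto
      finally show "(\<Sum>k<K. \<beta> ^ k) \<le> 1 / (1 - \<beta>)" .
    qed
    \<comment> \<open>The weights vanish above the diagonal, so the inner range extends to
      \<open>K\<close>; exchanging the sums then allows the column bound.\<close>
    also have "(\<Sum>k<K. \<Sum>j<Suc k. (1 - \<beta>) * \<bar>muon_weight \<beta> k j\<bar> * Eg j) \<le> (\<Sum>j<K. Eg j)"
    proof -
      have "(\<Sum>k<K. \<Sum>j<Suc k. (1 - \<beta>) * \<bar>muon_weight \<beta> k j\<bar> * Eg j)
          = (\<Sum>k<K. \<Sum>j<K. (1 - \<beta>) * \<bar>muon_weight \<beta> k j\<bar> * Eg j)"
        by (intro sum.cong refl sum.mono_neutral_left) (auto simp: muon_weight_eq)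
      also have "\<dots> = (\<Sum>j<K. \<Sum>k<K. (1 - \<beta>) * \<bar>muon_weight \<beta> k j\<bar> * Eg j)"
        by (rule sum.swap)
      also have "\<dots> = (\<Sum>j<K. ((1 - \<beta>) * (\<Sum>k<K. \<bar>muon_weight \<beta> k j\<bar>)) * Eg j)"
        by (simp add: sum_distrib_left sum_distrib_right)
      also have "\<dots> \<le> (\<Sum>j<K. 1 * Eg j)"
        using \<beta> by (intro sum_mono mult_right_mono sum_muon_weight_column_le Eg0)
      finally show ?thesis by simp
    qed
    finally show ?thesis using \<sigma> \<kappa>0 by (simp add: mult_left_mono)
  qed

  \<comment> \<open>Positivity of \<rho>\<close>
  have \<rho>_eq: "\<rho> = 1 - (1 + s) * \<kappa> * \<sigma>1"
    by (simp add: \<rho>_def \<kappa>_def q_def s_def d_def)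
  have \<rho>: "0 < \<rho>"
  proof -
    define t where "t = 2 * sqrt pi * (1 + s) * C\<alpha> powr (1 / \<alpha>) * \<sigma>1"
    have t: "0 \<le> t" using s \<sigma> by (simp add: t_def)
    \<comment> \<open>The exponent in the batch size condition is the reciprocal of
      \<open>q\<close>, so taking the power \<open>q\<close> isolates \<open>t\<close>.\<close>
    have "t powr (\<alpha> / (\<alpha> - 1)) < real B" using B by (simp add: t_def s_def d_def)
    then have "(t powr (\<alpha> / (\<alpha> - 1))) powr q < real B powr q"
      using \<alpha> by (intro powr_less_mono2) (auto simp: q_def)
    then have "t < real B powr q" using t \<alpha> by (simp add: powr_powr q_def)
    then have "t / real B powr q < 1" using B0 by simp
    moreover have "t / real B powr q = (1 + s) * \<kappa> * \<sigma>1"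
      by (simp add: t_def \<kappa>_def algebra_simps)
    ultimately show ?thesis using \<rho>_eq by linarith
  qed

  \<comment> \<open>Absorption and passage to the minimum\<close>
  define R where "R = (f X0 - fstar) / \<eta> + K * (L * d * \<eta> / 2)
     + (1 + s) * (ES 0 / (1 - \<beta>) + K * (\<beta>\<^sup>2 * (L * \<eta> * s) / (1 - \<beta>)) + \<kappa> * (K * (\<sigma>0 * \<Gamma> * (1 - \<beta>) powr q)))"
  \<comment> \<open>The \<open>\<sigma>1\<close> contribution is a multiple of the sum being
    bounded; moved to the left, it leaves exactly the factor \<open>\<rho>\<close>.\<close>
  have "\<rho> * (\<Sum>k<K. Eg k) \<le> R"
  proof -
    have "(\<Sum>k<K. Eg k) \<le> (f X0 - fstar + \<eta> * (1 + s) * (\<Sum>k<K. ES k) + K * (L * d * \<eta>\<^sup>2 / 2)) / \<eta>"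
      using descent \<eta> by (simp add: pos_le_divide_eq mult.commute)
    also have "\<dots> = (f X0 - fstar) / \<eta> + K * (L * d * \<eta> / 2) + (1 + s) * (\<Sum>k<K. ES k)"
      using \<eta> by (simp add: field_simps power2_eq_square)
    also have "(1 + s) * (\<Sum>k<K. ES k) \<le> (1 + s) * (ES 0 / (1 - \<beta>) + K * (\<beta>\<^sup>2 * (L * \<eta> * s) / (1 - \<beta>))
      + \<kappa> * (K * (\<sigma>0 * \<Gamma> * (1 - \<beta>) powr q) + \<sigma>1 * (\<Sum>k<K. Eg k)))"
      using ES_sum s by (intro mult_left_mono) auto
    finally show ?thesis unfolding R_def \<rho>_eq by (simp add: algebra_simps)
  qed
  moreover have "K * Min (Eg ` {..<K}) \<le> (\<Sum>k<K. Eg k)"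
  proof -
    have "(\<Sum>k<K. Min (Eg ` {..<K})) \<le> (\<Sum>k<K. Eg k)" by (intro sum_mono Min_le) auto
    then show ?thesis by simp
  qed
  then have "\<rho> * (K * Min (Eg ` {..<K})) \<le> \<rho> * (\<Sum>k<K. Eg k)"
    using \<rho> by (intro mult_left_mono) auto
  ultimately have "\<rho> * (K * Min (Eg ` {..<K})) \<le> R" by linarith
  then have "Min (Eg ` {..<K}) \<le> R / (\<rho> * K)"
    using \<rho> K by (simp add: pos_le_divide_eq mult_ac)
  \<comment> \<open>The summand with the initial gradient is nonnegative and is added to reach the
    stated form.\<close>
  also have "\<dots> \<le> R / (\<rho> * K) + (1 + s) * (\<kappa> * \<sigma>1 * norm (gradf X0)) / (\<rho> * K)"
    using \<rho> s \<kappa>0 \<sigma> by simp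
  also have "\<dots> = (f X0 - fstar) / (\<eta> * \<rho> * K) + L * d * \<eta> / (2 * \<rho>)
      + (1 + s) * ES 0 / ((1 - \<beta>) * K * \<rho>)
      + \<beta>\<^sup>2 / ((1 - \<beta>) * \<rho>) * L * \<eta> * s * (1 + s)
      + (1 + s) * (2 * sqrt pi * C\<alpha> powr (1 / \<alpha>)) / (\<rho> * real B powr q) * \<Gamma> * \<sigma>0 * (1 - \<beta>) powr q
      + (1 + s) * (2 * sqrt pi * C\<alpha> powr (1 / \<alpha>) * \<sigma>1 * norm (gradf X0)) / (\<rho> * real B powr q * K)"
  proof -
    have "real K \<noteq> 0" "\<rho> \<noteq> 0" "\<eta> \<noteq> 0" "1 - \<beta> \<noteq> 0" "real B powr q \<noteq> 0" using K \<rho> \<eta> \<beta> B0 by auto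
    then show ?thesis
      unfolding R_def \<kappa>_def by (simp add: divide_simps) (simp add: algebra_simps)
  qed
  finally show ?thesis
    unfolding Eg_def ES_def S_def D_def M_def Gb_eq[symmetric] s_def d_def q_def \<Gamma>_def
    by (simp add: X_0)
qed

end
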